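(* As $d\to\infty$ (through integers), \[ i_V(d)\ \ge\ 1-\frac{2}{d}+O\!\left(\frac{\log d}{d^2}\right). \] That is, there is a function $\varepsilon(d)=O((\log d)/d^2)$ such that $i_V(d)\ge 1-2/d+\varepsilon(d)$ for all sufficiently large $d$.
   Context: For a graph $G$ on $n$ vertices with vertex set $V$ and $U\subseteq V$, $\partial_V(U)$ is the set of vertices not in $U$ that are adjacent to some vertex of $U$. $i_{V,1/2}(G)=\min |\partial_V(U)|/|U|$ over nonempty $U\subseteq V$ with $|U|\le n/2$. $\mathcal G_{n,d}$ is the uniform probability space on simple $d$-regular graphs on $n$ (labelled) vertices ($dn$ even; $n\to\infty$ through such $n$). A property holds a.a.s. if its probability tends to $1$ as $n\to\infty$ (with $d$ fixed). Define $i_V(d)=\sup\{\ell : i_{V,1/2}(\mathcal G_{n,d})\ge \ell \text{ a.a.s.}\}$. *)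

theory Defs
  imports "HOL-Probability.Probability" "HOL-Library.Landau_Symbols"
begin

text \<open>A graph on a vertex set \<open>V\<close> is given by its set \<open>E\<close> of edges, which are two-element
  subsets of \<open>V\<close>; so distinct labelled simple graphs are distinct edge sets.\<close>

definition simple_graph :: "'v set \<Rightarrow> 'v set set \<Rightarrow> bool" where
  "simple_graph V E \<longleftrightarrow> E \<subseteq> {e. e \<subseteq> V \<and> card e = 2}"

definition regular_graphs :: "nat \<Rightarrow> nat \<Rightarrow> nat set set set" where
  "regular_graphs n d =
     {E. simple_graph {..<n} E \<and> (\<forall>v<n. card {e \<in> E. v \<in> e} = d)}"

definition vertex_boundary :: "'v set \<Rightarrow> 'v set set \<Rightarrow> 'v set \<Rightarrow> 'v set" where
  "vertex_boundary V E U = {v \<in> V - U. \<exists>u\<in>U. {u, v} \<in> E}"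

text \<open>The minimum is over a nonempty family as soon as \<open>V\<close> has at least two elements.\<close>

definition half_vertex_expansion :: "'v set \<Rightarrow> 'v set set \<Rightarrow> real" where
  "half_vertex_expansion V E =
     Min {real (card (vertex_boundary V E U)) / real (card U) | U.
            U \<subseteq> V \<and> U \<noteq> {} \<and> real (card U) \<le> real (card V) / 2}"

text \<open>The set \<open>regular_graphs n d\<close> is finite, and it is nonempty whenever \<open>d < n\<close> and \<open>d * n\<close>
  is even, so the uniform distribution below is meaningful for all large admissible \<open>n\<close>.\<close>

definition random_regular_graph :: "nat \<Rightarrow> nat \<Rightarrow> nat set set pmf" where
  "random_regular_graph n d = pmf_of_set (regular_graphs n d)"

definition holds_aas :: "nat \<Rightarrow> (nat \<Rightarrow> nat set set \<Rightarrow> bool) \<Rightarrow> bool" where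
  "holds_aas d P \<longleftrightarrow>
     ((\<lambda>n. measure_pmf.prob (random_regular_graph n d) {E. P n E}) \<longlongrightarrow> 1)
       (inf at_top (principal {n. even (d * n)}))"

text \<open>The set under the supremum contains \<open>0\<close>, and it is bounded above because a set of
  \<open>n div 2\<close> vertices has at most \<open>n - n div 2\<close> boundary vertices.\<close>

definition iV :: "nat \<Rightarrow> real" where
  "iV d = Sup {l. holds_aas d (\<lambda>n E. half_vertex_expansion {..<n} E \<ge> l)}"

end

theory Submission
  imports Defs "HOL-Real_Asymp.Real_Asymp"
begin

text \<open>
  The bound is a first-moment argument in the pairing model, with
  \<open>l = 1 - 2/d - 5000 (ln d)/d\<^sup>2\<close> as the expansion to be reached. Attach \<open>d\<close> points to each of the
  \<open>n\<close> vertices and pair the points at random; contracting the points of each vertex gives a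
  \<open>d\<close>-regular multigraph.

  Suppose that a set \<open>U\<close> of \<open>s \<le> n/2\<close> vertices has fewer than \<open>l s\<close> neighbours. Then there is a set
  \<open>W\<close> of \<open>w = n - s - \<lfloor>l s\<rfloor>\<close> vertices without edges to \<open>U\<close>. The critical case is \<open>s = n/2\<close>: there
  \<open>w\<close> is about \<open>n/d\<close> and each of the \<open>d w\<close> points of \<open>W\<close> avoids the points of \<open>U\<close> with probability
  about \<open>1/2\<close>. The \<open>2\<^sup>n\<close> choices of \<open>U\<close> are therefore paid for as soon as \<open>d w \<ge> n\<close>, which is the
  term \<open>2/d\<close> in \<open>l\<close>. The choices of \<open>W\<close> and the correction to the probability \<open>1/2\<close>, which comes
  from pairs inside \<open>W\<close>, cost a factor \<open>exp (O(n (ln d)/d))\<close>; the term of order \<open>(ln d)/d\<^sup>2\<close> in \<open>l\<close>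
  makes \<open>d w\<close> larger by a constant multiple of \<open>n (ln d)/d\<close> and pays for them. For
  \<open>2 s \<le> (1 - 20/d) n\<close> a cruder estimate is enough: all edges at \<open>U\<close> stay inside \<open>U \<union> T\<close> for some
  set \<open>T\<close> of \<open>s\<close> vertices, which has probability at most \<open>(2s/n)\<^bsup>ds/2\<^esup>\<close>, small compared
  with the inverse square of \<open>n choose s\<close>. Both probabilities come from one inequality,
  \<open>card_pairings_avoiding_le\<close>; the two ranges are \<open>large_set_term_le\<close> and \<open>small_set_term_le\<close>.

  Two facts carry the result over to uniform simple regular graphs. Every simple \<open>d\<close>-regular graph
  comes from the same number of pairings (\<open>card_simple_pairings_of_graph\<close>), and a proportion of the
  pairings bounded away from \<open>0\<close> in terms of \<open>d\<close> alone is simple (\<open>card_pairings_le_card_simple\<close>).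
  The second fact is proved by switching edges: a switching that removes a loop or a parallel edge
  can be chosen in order of \<open>n d\<close> ways, and a pairing results from at most \<open>O(n d\<^sup>3)\<close> switchings.
\<close>

section \<open>Pairings of a finite set\<close>

text \<open>A perfect matching of \<open>X\<close> is encoded by its partner map. Fixing all points outside \<open>X\<close> makes
  the map unique, and removing a pair from the matching becomes two function updates.\<close>
definition pairings :: "'a set \<Rightarrow> ('a \<Rightarrow> 'a) set" where
  "pairings X = {f. (\<forall>x\<in>X. f x \<in> X \<and> f x \<noteq> x \<and> f (f x) = x) \<and> (\<forall>x. x \<notin> X \<longrightarrow> f x = x)}"

text \<open>The double factorial \<open>(m - 1)!!\<close> for even \<open>m\<close>, and \<open>0\<close> for odd \<open>m\<close>.\<close>
fun pairing_count :: "nat \<Rightarrow> nat" where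
  "pairing_count 0 = 1"
| "pairing_count (Suc 0) = 0"
| "pairing_count (Suc (Suc m)) = Suc m * pairing_count m"

lemma pairingsD:
  assumes "f \<in> pairings X"
  shows "x \<in> X \<Longrightarrow> f x \<in> X" "x \<in> X \<Longrightarrow> f x \<noteq> x" "f (f x) = x" "x \<notin> X \<Longrightarrow> f x = x"
  using assms by (auto simp: pairings_def)

lemma pairings_eq_iff: "f \<in> pairings X \<Longrightarrow> f x = f y \<longleftrightarrow> x = y"
  by (metis pairingsD(3))

lemma finite_pairings:
  assumes "finite X"
  shows "finite (pairings X)"
proof (rule finite_subset)
  show "pairings X \<subseteq> {f. f permutes X}"
  proof
    fix f assume f: "f \<in> pairings X"
    have "\<exists>!x. f x = y" for y
      by (rule ex1I[of _ "f y"]) (use pairingsD(3)[OF f] in metis)+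
    then show "f \<in> {f. f permutes X}"
      using pairingsD(4)[OF f] by (auto simp: permutes_def)
  qed
  show "finite {f. f permutes X}"
    using assms by (rule finite_permutations)
qed

lemma bij_betw_pairings_remove_pair:
  assumes "x \<in> X" "y \<in> X" "x \<noteq> y"
  shows "bij_betw (\<lambda>f. f(x := x, y := y)) {f \<in> pairings X. f x = y} (pairings (X - {x, y}))"
proof (rule bij_betw_byWitness[where f' = "\<lambda>g. g(x := y, y := x)"])
  show "\<forall>f\<in>{f \<in> pairings X. f x = y}. (f(x := x, y := y))(x := y, y := x) = f"
    using assms by (auto simp: fun_eq_iff pairingsD(3))
  show "\<forall>g\<in>pairings (X - {x, y}). (g(x := y, y := x))(x := x, y := y) = g"
    using assms by (auto simp: fun_eq_iff pairingsD(4))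
  show "(\<lambda>f. f(x := x, y := y)) ` {f \<in> pairings X. f x = y} \<subseteq> pairings (X - {x, y})"
  proof clarify
    fix f assume f: "f \<in> pairings X" and y: "y = f x"
    have "f z \<noteq> f x" if "z \<noteq> x" for z
      using that pairings_eq_iff[OF f] by blast
    moreover have "f z \<noteq> x" if "z \<noteq> f x" for z
      using that pairingsD(3)[OF f] by metis
    ultimately show "f(x := x, f x := f x) \<in> pairings (X - {x, f x})"
      using pairingsD[OF f] unfolding pairings_def by auto
  qed
  show "(\<lambda>g. g(x := y, y := x)) ` pairings (X - {x, y}) \<subseteq> {f \<in> pairings X. f x = y}"
  proof clarify
    fix g assume g: "g \<in> pairings (X - {x, y})"
    have "g z \<in> X - {x, y}" if "z \<in> X - {x, y}" for z
      using pairingsD(1)[OF g that] .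
    moreover have "g z \<noteq> z" if "z \<in> X - {x, y}" for z
      using pairingsD(2)[OF g that] .
    ultimately have "g(x := y, y := x) \<in> pairings X"
      using assms pairingsD(3,4)[OF g] unfolding pairings_def by auto
    then show "g(x := y, y := x) \<in> pairings X \<and> (g(x := y, y := x)) x = y"
      using assms by simp
  qed
qed

lemma card_pairings_containing:
  assumes "x \<in> X" "y \<in> X" "x \<noteq> y"
  shows "card {f \<in> pairings X. f x = y} = card (pairings (X - {x, y}))"
  using bij_betw_same_card[OF bij_betw_pairings_remove_pair[OF assms]] .

lemma pairing_count_step: "2 \<le> m \<Longrightarrow> pairing_count m = (m - 1) * pairing_count (m - 2)"
  by (cases m rule: pairing_count.cases) auto

lemma pairing_count_pos: "even m \<Longrightarrow> 0 < pairing_count m"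
  by (induction m rule: pairing_count.induct) auto

lemma card_pairings:
  assumes "finite X"
  shows "card (pairings X) = pairing_count (card X)"
  using assms
proof (induction "card X" arbitrary: X rule: less_induct)
  case less
  show ?case
  proof (cases "X = {}")
    case True
    then have "pairings X = {id}" by (auto simp: pairings_def)
    then show ?thesis using True by simp
  next
    case False
    then obtain x where x: "x \<in> X" by blast
    have "pairings X = (\<Union>y\<in>X - {x}. {f \<in> pairings X. f x = y})"
      using x pairingsD(1,2)[of _ X x] by blast
    then have "card (pairings X) = card (\<Union>y\<in>X - {x}. {f \<in> pairings X. f x = y})"
      by simp
    also have "\<dots> = (\<Sum>y\<in>X - {x}. card {f \<in> pairings X. f x = y})"
      using less.prems finite_pairings[OF less.prems] by (intro card_UN_disjoint) auto
    also have "\<dots> = (\<Sum>y\<in>X - {x}. pairing_count (card X - 2))"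
    proof (rule sum.cong[OF refl])
      fix y assume y: "y \<in> X - {x}"
      have c: "card (X - {x, y}) = card X - 2"
        using x y less.prems by (subst card_Diff_subset) auto
      have "0 < card X" using x less.prems by (auto simp: card_gt_0_iff)
      then show "card {f \<in> pairings X. f x = y} = pairing_count (card X - 2)"
        using less.hyps[of "X - {x, y}"] c less.prems x y card_pairings_containing[of x X y] by auto
    qed
    also have "\<dots> = (card X - 1) * pairing_count (card X - 2)"
      using x less.prems by simp
    also have "\<dots> = pairing_count (card X)"
    proof (cases "2 \<le> card X")
      case False
      moreover have "card X \<noteq> 0" using x less.prems by auto
      ultimately have "card X = Suc 0" by simp
      then show ?thesis by simp
    qed (simp add: pairing_count_step)
    finally show ?thesis .
  qed
qed

text \<open>Reveal the partners of the points of \<open>A\<close> one at a time. With \<open>a\<close> and \<open>b\<close> points left in \<open>A\<close> and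
  \<open>B\<close>, and \<open>m\<close> points left in total, the next point of \<open>A\<close> is joined to \<open>B\<close> with probability
  \<open>b/(m - 1)\<close>, which uses one point of \<open>A\<close>, and to \<open>A\<close> with probability \<open>(a - 1)/(m - 1)\<close>, which uses
  two. So \<open>L\<^sup>a\<close> bounds the probability of never meeting \<open>C\<close> as soon as
  \<open>b L + (a - 1) \<le> (m - 1) L\<^sup>2\<close> at every stage. The condition \<open>b L + a \<le> m L\<^sup>2\<close> implies this, and it
  persists when points of \<open>A\<close> and \<open>B\<close> are used up because \<open>L \<le> 1\<close>.\<close>
lemma card_pairings_avoiding_le:
  fixes L :: real
  assumes "finite A" "finite B" "finite C" "A \<inter> B = {}" "A \<inter> C = {}" "B \<inter> C = {}"
    and L: "0 \<le> L" "L \<le> 1"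
    and key: "card B * L + card A \<le> (card A + card B + card C) * L\<^sup>2"
  shows "card {f \<in> pairings (A \<union> B \<union> C). \<forall>x\<in>A. f x \<notin> C}
           \<le> pairing_count (card A + card B + card C) * L ^ card A"
  using assms(1-6) key
proof (induction "card A" arbitrary: A B rule: less_induct)
  case less
  define X where "X = A \<union> B \<union> C"
  define m where "m = card A + card B + card C"
  have finX: "finite X" using less.prems by (simp add: X_def)
  have cardX: "card X = m"
    using less.prems unfolding X_def m_def by (simp add: card_Un_disjoint Int_Un_distrib2)
  have L2: "L\<^sup>2 \<le> L" "L\<^sup>2 \<le> 1"
    using L by (auto simp: power2_eq_square mult_left_le_one_le mult_le_one)
  show ?case
  proof (cases "A = {}")
    case True
    have "card {f \<in> pairings X. \<forall>x\<in>A. f x \<notin> C} \<le> card (pairings X)"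
      by (intro card_mono finite_pairings finX) auto
    then show ?thesis
      using True card_pairings[OF finX] cardX unfolding X_def m_def by simp
  next
    case False
    then obtain x where x: "x \<in> A" by blast
    define a where "a = card A"
    define b where "b = card B"
    have a: "a = Suc (card (A - {x}))"
      using x less.prems(1) unfolding a_def by (simp only: card_Suc_Diff1)
    define P where "P y = {f \<in> pairings X. (\<forall>x\<in>A. f x \<notin> C) \<and> f x = y}" for y
    have finP: "finite (P y)" for y
      unfolding P_def using finite_pairings[OF finX] by simp
    have key': "b * L + a \<le> m * L\<^sup>2"
      using less.prems(7) unfolding a_def b_def m_def by simp
    have step: "card (P y) \<le> card {f \<in> pairings (A' \<union> B' \<union> C). \<forall>z\<in>A'. f z \<notin> C}"
      if "y \<in> X" "y \<noteq> x" "y \<notin> C" and A': "A' = A - {x, y}" and B': "B' = B - {y}" for y A' B'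
    proof (rule card_inj_on_le)
      have XX: "A' \<union> B' \<union> C = X - {x, y}"
        using that x less.prems unfolding X_def by blast
      have xX: "x \<in> X" using x by (simp add: X_def)
      note bij = bij_betw_pairings_remove_pair[OF xX \<open>y \<in> X\<close> \<open>y \<noteq> x\<close>[symmetric]]
      show "inj_on (\<lambda>f. f(x := x, y := y)) (P y)"
        using bij unfolding P_def bij_betw_def by (auto intro: inj_on_subset)
      have "f(x := x, y := y) \<in> pairings (X - {x, y})" if "f \<in> P y" for f
        using that bij unfolding P_def bij_betw_def by blast
      then show "(\<lambda>f. f(x := x, y := y)) ` P y \<subseteq> {f \<in> pairings (A' \<union> B' \<union> C). \<forall>z\<in>A'. f z \<notin> C}"
        unfolding XX using A' by (auto simp: P_def)
      show "finite {f \<in> pairings (A' \<union> B' \<union> C). \<forall>z\<in>A'. f z \<notin> C}"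
        using less.prems A' B' by (simp add: finite_pairings)
    qed
    have PA: "card (P y) \<le> pairing_count (m - 2) * L ^ (a - 2)" if y: "y \<in> A - {x}" for y
    proof -
      have c: "card (A - {x, y}) = a - 2"
        using x y less.prems unfolding a_def by (subst card_Diff_subset) auto
      have a2: "2 \<le> a"
        using y less.prems unfolding a by (auto simp: Suc_le_eq card_gt_0_iff)
      have B: "B - {y} = B" using y less.prems by auto
      have "real (card (P y)) \<le> card {f \<in> pairings ((A - {x, y}) \<union> B \<union> C). \<forall>z\<in>A - {x, y}. f z \<notin> C}"
        using step[of y "A - {x, y}" B] y less.prems B by (auto simp: X_def)
      also have "\<dots> \<le> pairing_count (card (A - {x, y}) + card B + card C) * L ^ card (A - {x, y})"
      proof (rule less.hyps)
        show "card (A - {x, y}) < card A" using c a2 a_def by simp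
        have "b * L + a - 2 \<le> m * L\<^sup>2 - 2 * L\<^sup>2" using key' L2 by linarith
        moreover have "real a = real (card (A - {x, y})) + 2" using c a2 by simp
        moreover have "real m = real a + real b + card C" by (simp add: m_def a_def b_def)
        ultimately show "card B * L + card (A - {x, y})
            \<le> (card (A - {x, y}) + card B + card C) * L\<^sup>2"
          unfolding b_def[symmetric] by (simp add: algebra_simps)
      qed (use less.prems in auto)
      also have "card (A - {x, y}) + card B + card C = m - 2"
        using c a2 by (simp add: m_def a_def)
      finally show ?thesis unfolding c .
    qed
    have PB: "card (P y) \<le> pairing_count (m - 2) * L ^ (a - 1)" if y: "y \<in> B" for y
    proof -
      have yA: "y \<notin> A" "y \<notin> C" "y \<noteq> x" using y x less.prems by auto
      have A: "A - {x, y} = A - {x}" using yA by auto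
      have c: "card (A - {x}) = a - 1" "card (B - {y}) = b - 1"
        using a y less.prems by (simp_all add: b_def)
      have ab: "1 \<le> a" "1 \<le> b"
        using a y less.prems by (auto simp: b_def Suc_le_eq card_gt_0_iff)
      have "real (card (P y)) \<le> card {f \<in> pairings ((A - {x}) \<union> (B - {y}) \<union> C). \<forall>z\<in>A - {x}. f z \<notin> C}"
        using step[of y "A - {x}" "B - {y}"] y yA A by (auto simp: X_def)
      also have "\<dots> \<le> pairing_count (card (A - {x}) + card (B - {y}) + card C) * L ^ card (A - {x})"
      proof (rule less.hyps)
        show "card (A - {x}) < card A" using a a_def by simp
        have "b * L + a - (L + 1) \<le> m * L\<^sup>2 - 2 * L\<^sup>2" using key' L2 by linarith
        moreover have "real (card (A - {x})) = a - 1" "real (card (B - {y})) = b - 1"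
          using c ab by simp_all
        moreover have "real m = real a + real b + card C" by (simp add: m_def a_def b_def)
        ultimately show "card (B - {y}) * L + card (A - {x})
            \<le> (card (A - {x}) + card (B - {y}) + card C) * L\<^sup>2"
          using ab c by (simp add: algebra_simps of_nat_diff)
      qed (use less.prems in auto)
      also have "card (A - {x}) + card (B - {y}) + card C = m - 2"
        using c ab by (simp add: m_def a_def b_def)
      finally show ?thesis unfolding c .
    qed
    have "{f \<in> pairings X. \<forall>x\<in>A. f x \<notin> C} \<subseteq> (\<Union>y\<in>A - {x}. P y) \<union> (\<Union>y\<in>B. P y)"
    proof
      fix f assume f: "f \<in> {f \<in> pairings X. \<forall>x\<in>A. f x \<notin> C}"
      then have "f x \<in> X" "f x \<noteq> x" "f x \<notin> C" using x pairingsD[of f X x] by (auto simp: X_def)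
      then show "f \<in> (\<Union>y\<in>A - {x}. P y) \<union> (\<Union>y\<in>B. P y)"
        using f by (auto simp: X_def P_def)
    qed
    then have "card {f \<in> pairings X. \<forall>x\<in>A. f x \<notin> C}
        \<le> card ((\<Union>y\<in>A - {x}. P y) \<union> (\<Union>y\<in>B. P y))"
      using less.prems finP by (intro card_mono) auto
    also have "\<dots> \<le> card (\<Union>y\<in>A - {x}. P y) + card (\<Union>y\<in>B. P y)"
      by (rule card_Un_le)
    also have "\<dots> \<le> (\<Sum>y\<in>A - {x}. card (P y)) + (\<Sum>y\<in>B. card (P y))"
      using less.prems by (intro add_mono card_UN_le) auto
    finally have "real (card {f \<in> pairings X. \<forall>x\<in>A. f x \<notin> C})
        \<le> (\<Sum>y\<in>A - {x}. real (card (P y))) + (\<Sum>y\<in>B. real (card (P y)))"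
      by (simp flip: of_nat_sum of_nat_add)
    also have "\<dots> \<le> (\<Sum>y\<in>A - {x}. pairing_count (m - 2) * L ^ (a - 2))
                   + (\<Sum>y\<in>B. pairing_count (m - 2) * L ^ (a - 1))"
      by (intro add_mono sum_mono PA PB)
    also have "\<dots> = pairing_count (m - 2) * ((a - 1) * L ^ (a - 2) + b * L ^ (a - 1))"
      using a by (simp add: b_def algebra_simps)
    also have "\<dots> \<le> pairing_count m * L ^ a"
    proof (cases "2 \<le> m")
      case False
      then have "a = 1" "b = 0" using a by (auto simp: m_def a_def[symmetric] b_def)
      then show ?thesis using L by simp
    next
      case m: True
      have "(a - 1) * L ^ (a - 2) + b * L ^ (a - 1) \<le> (m - 1) * L ^ a"
      proof (cases "2 \<le> a")
        case True
        then obtain k where k: "a = k + 2" by (metis add.commute le_Suc_ex)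
        have "(a - 1) * L ^ (a - 2) + b * L ^ (a - 1) = L ^ k * (real a - 1 + b * L)"
          unfolding k by (simp add: algebra_simps)
        also have "\<dots> \<le> L ^ k * ((real m - 1) * L\<^sup>2)"
          using key' L2 L by (intro mult_left_mono) (auto simp: algebra_simps)
        also have "\<dots> = (m - 1) * L ^ a"
          using m by (simp add: k power_add power2_eq_square of_nat_diff)
        finally show ?thesis .
      next
        case False
        then have a1: "a = 1" using a by simp
        then have "L \<noteq> 0" using key' by (intro notI) simp
        then have "L > 0" using L by simp
        moreover have "b * L \<le> ((m - 1) * L) * L"
          using key' a1 L2 m by (simp add: algebra_simps power2_eq_square of_nat_diff)
        ultimately have "b \<le> (m - 1) * L" by simp
        then show ?thesis using a1 by simp
      qed
      then have "pairing_count (m - 2) * ((a - 1) * L ^ (a - 2) + b * L ^ (a - 1))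
          \<le> pairing_count (m - 2) * ((m - 1) * L ^ a)"
        by (intro mult_left_mono) auto
      then show ?thesis using pairing_count_step[OF m] by (simp add: mult_ac)
    qed
    finally show ?thesis unfolding X_def m_def a_def .
  qed
qed

section \<open>Pairings without loops and parallel edges\<close>

text \<open>The point \<open>(v, i)\<close> is the \<open>i\<close>-th half-edge at the vertex \<open>v\<close>.\<close>
definition points :: "nat \<Rightarrow> nat \<Rightarrow> (nat \<times> nat) set" where
  "points n d = {..<n} \<times> {..<d}"

text \<open>The points that lie on a loop or on one of several parallel edges of the multigraph that
  arises from \<open>f\<close> by contracting points with the same first component.\<close>
definition defects :: "('v \<times> 'i) set \<Rightarrow> ('v \<times> 'i \<Rightarrow> 'v \<times> 'i) \<Rightarrow> ('v \<times> 'i) set" where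
  "defects X f = {p \<in> X. fst (f p) = fst p \<or>
     (\<exists>r\<in>X. r \<noteq> p \<and> fst r = fst p \<and> fst (f r) = fst (f p))}"

text \<open>The points at the vertex of \<open>p\<close> and at its neighbours.\<close>
definition close_points :: "('v \<times> 'i) set \<Rightarrow> ('v \<times> 'i \<Rightarrow> 'v \<times> 'i) \<Rightarrow> 'v \<times> 'i \<Rightarrow> ('v \<times> 'i) set" where
  "close_points X f p = {q \<in> X. fst q = fst p \<or> (\<exists>r\<in>X. fst r = fst p \<and> fst (f r) = fst q)}"

text \<open>The pairs \<open>{p, f p}\<close> and \<open>{q, f q}\<close> are replaced by \<open>{p, q}\<close> and \<open>{f p, f q}\<close>.\<close>
definition switch :: "('a \<Rightarrow> 'a) \<Rightarrow> 'a \<Rightarrow> 'a \<Rightarrow> ('a \<Rightarrow> 'a)" where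
  "switch f p q = f(p := q, q := p, f p := f q, f q := f p)"

lemma finite_points [simp]: "finite (points n d)"
  and card_points: "card (points n d) = n * d"
  by (simp_all add: points_def)

lemma finite_defects [simp]: "finite X \<Longrightarrow> finite (defects X f)"
  by (simp add: defects_def)

lemma defects_partner:
  assumes f: "f \<in> pairings X" and p: "p \<in> defects X f"
  shows "f p \<in> defects X f"
proof -
  have pX: "p \<in> X" using p by (simp add: defects_def)
  have "fst (f p) = fst p \<or> (\<exists>r\<in>X. r \<noteq> p \<and> fst r = fst p \<and> fst (f r) = fst (f p))"
    using p by (simp add: defects_def)
  then show ?thesis
  proof
    assume "fst (f p) = fst p"
    then show ?thesis using pairingsD[OF f] pX by (simp add: defects_def)
  next
    assume "\<exists>r\<in>X. r \<noteq> p \<and> fst r = fst p \<and> fst (f r) = fst (f p)"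
    then obtain r where r: "r \<in> X" "r \<noteq> p" "fst r = fst p" "fst (f r) = fst (f p)" by blast
    have "f r \<in> X" "f r \<noteq> f p" "fst (f r) = fst (f p)" "fst (f (f r)) = fst (f (f p))"
      using r pairingsD(1)[OF f] pairings_eq_iff[OF f] by (simp_all add: pairingsD(3)[OF f])
    then show ?thesis using pairingsD(1)[OF f pX] unfolding defects_def by blast
  qed
qed

lemma switch_apply:
  assumes f: "f \<in> pairings X" and X: "p \<in> X" "q \<in> X" and ne: "q \<noteq> p" "q \<noteq> f p"
  shows "switch f p q p = q" "switch f p q q = p"
    "switch f p q (f p) = f q" "switch f p q (f q) = f p"
    "z \<notin> {p, q, f p, f q} \<Longrightarrow> switch f p q z = f z"
proof -
  have "f q \<noteq> p" using ne pairingsD(3)[OF f] by metis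
  moreover have "f q \<noteq> f p" using ne pairings_eq_iff[OF f] by simp
  ultimately show "switch f p q p = q" "switch f p q q = p"
    "switch f p q (f p) = f q" "switch f p q (f q) = f p"
    "z \<notin> {p, q, f p, f q} \<Longrightarrow> switch f p q z = f z"
    using X ne pairingsD(2)[OF f X(1)] pairingsD(2)[OF f X(2)]
    by (auto simp: switch_def)
qed

lemma switch_pairings:
  assumes f: "f \<in> pairings X" and X: "p \<in> X" "q \<in> X" and ne: "q \<noteq> p" "q \<noteq> f p"
  shows "switch f p q \<in> pairings X"
proof -
  let ?g = "switch f p q"
  note app = switch_apply[OF assms]
  have fX: "f p \<in> X" "f q \<in> X" using X pairingsD(1)[OF f] by auto
  have fne: "f p \<noteq> f q" using ne pairings_eq_iff[OF f] by auto
  have "?g z \<in> X \<and> ?g z \<noteq> z \<and> ?g (?g z) = z" if z: "z \<in> X" for z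
  proof (cases "z \<in> {p, q, f p, f q}")
    case True
    then show ?thesis using app X fX ne fne by auto
  next
    case False
    then have "f z \<notin> {p, q, f p, f q}"
      using pairingsD(3)[OF f] by (metis insert_iff singletonD)
    then show ?thesis
      using app(5)[OF False] app(5)[of "f z"] pairingsD[OF f] z by simp
  qed
  moreover have "?g z = z" if "z \<notin> X" for z
    using that app(5)[of z] X fX pairingsD(4)[OF f] by auto
  ultimately show ?thesis by (simp add: pairings_def)
qed

text \<open>A switching is determined by its result, the point \<open>p\<close> and the old partner of \<open>p\<close>. The double
  counting of switchings rests on this.\<close>
lemma switch_switch:
  assumes f: "f \<in> pairings X" and X: "p \<in> X" "q \<in> X" and ne: "q \<noteq> p" "q \<noteq> f p"
  shows "switch (switch f p q) p (f p) = f"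
proof
  fix z
  note app = switch_apply[OF assms]
  have "switch (switch f p q) p (f p)
      = (switch f p q)(p := f p, f p := p, q := f q, f q := q)"
    unfolding switch_def[of "switch f p q"] using app by simp
  moreover have "f q \<noteq> p" using ne pairingsD(3)[OF f] by metis
  moreover have "f q \<noteq> f p" using ne pairings_eq_iff[OF f] by simp
  ultimately show "switch (switch f p q) p (f p) z = f z"
    using app(5)[of z] ne X pairingsD(2)[OF f X(1)] pairingsD(2)[OF f X(2)] pairingsD(3)[OF f]
    by auto
qed

lemma card_vertex_points_le: "card {q \<in> points n d. fst q = v} \<le> d"
proof -
  have "{q \<in> points n d. fst q = v} \<subseteq> {v} \<times> {..<d}"
    by (auto simp: points_def)
  then have "card {q \<in> points n d. fst q = v} \<le> card ({v} \<times> {..<d})"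
    by (intro card_mono) auto
  then show ?thesis by (simp add: card_cartesian_product)
qed

lemma card_close_points_le: "card (close_points (points n d) f p) \<le> d + d * d"
proof -
  let ?P = "\<lambda>v. {q \<in> points n d. fst q = v}"
  have fin: "finite (?P v)" for v by simp
  have "close_points (points n d) f p \<subseteq> ?P (fst p) \<union> (\<Union>r\<in>?P (fst p). ?P (fst (f r)))"
    by (auto simp: close_points_def)
  then have "card (close_points (points n d) f p)
      \<le> card (?P (fst p) \<union> (\<Union>r\<in>?P (fst p). ?P (fst (f r))))"
    by (intro card_mono) auto
  also have "\<dots> \<le> card (?P (fst p)) + card (\<Union>r\<in>?P (fst p). ?P (fst (f r)))"
    by (rule card_Un_le)
  also have "card (\<Union>r\<in>?P (fst p). ?P (fst (f r))) \<le> (\<Sum>r\<in>?P (fst p). card (?P (fst (f r))))"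
    by (rule card_UN_le) simp
  also have "\<dots> \<le> (\<Sum>r\<in>?P (fst p). d)"
    by (intro sum_mono card_vertex_points_le)
  also have "\<dots> \<le> d * d"
    using card_vertex_points_le[of n d "fst p"] by simp
  also have "card (?P (fst p)) \<le> d"
    by (rule card_vertex_points_le)
  finally show ?thesis by simp
qed

text \<open>Count the switchings that start in \<open>S\<close> at a defect \<open>p\<close> and lead to \<open>S'\<close>. To undo a switching it
  suffices to know the result \<open>g\<close>, the point \<open>p\<close> and its old partner. Since \<open>p\<close> was a defect, the
  old partner is at the same vertex or at the other end of a parallel edge. If that parallel edge
  survives the switching, the old partner is close to \<open>p\<close> in \<open>g\<close>, which leaves only \<open>d + d\<^sup>2\<close>
  possibilities instead of \<open>n d\<close>.\<close>
lemma switching_double_count: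
  fixes n d N :: nat
  defines "X \<equiv> points n d"
  assumes S: "S \<subseteq> pairings X" and S': "S' \<subseteq> pairings X"
    and many: "\<And>f p. f \<in> S \<Longrightarrow> p \<in> defects X f \<Longrightarrow>
      N \<le> card {q \<in> X. q \<noteq> p \<and> q \<noteq> f p \<and> switch f p q \<in> S' \<and> f p \<in> close_points X (switch f p q) p}"
  shows "(\<Sum>f\<in>S. card (defects X f)) * N \<le> card S' * (n * d * (d + d * d))"
proof -
  have finX: "finite X" by (simp add: X_def)
  have finS: "finite S" "finite S'"
    using S S' finite_pairings[OF finX] finite_subset by auto
  define Q where "Q f p = {q \<in> X. q \<noteq> p \<and> q \<noteq> f p \<and> switch f p q \<in> S' \<and>
      f p \<in> close_points X (switch f p q) p}" for f p
  define Tr where "Tr = (SIGMA f:S. SIGMA p:defects X f. Q f p)"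
  define Im where "Im = (SIGMA g:S'. SIGMA p:X. close_points X g p)"
  define \<Phi> :: "_ \<Rightarrow> _ \<times> (nat \<times> nat) \<times> (nat \<times> nat)"
    where "\<Phi> = (\<lambda>(f, p, q). (switch f p q, p, f p))"
  have finQ: "finite (Q f p)" "finite (close_points X f p)" for f p
    using finX by (simp_all add: Q_def close_points_def)
  have "(\<Sum>f\<in>S. card (defects X f)) * N = (\<Sum>f\<in>S. \<Sum>p\<in>defects X f. N)"
    by (simp add: sum_distrib_right)
  also have "\<dots> \<le> (\<Sum>f\<in>S. \<Sum>p\<in>defects X f. card (Q f p))"
    unfolding Q_def by (intro sum_mono many)
  also have "\<dots> = card Tr"
    unfolding Tr_def using finS finX finQ by (simp add: card_SigmaI)
  also have "card Tr \<le> card Im"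
  proof (rule card_inj_on_le)
    have inv: "switch (switch f p q) p (f p) = f" "switch f p q p = q"
      if "(f, p, q) \<in> Tr" for f p q
      using that S switch_switch[of f X p q] switch_apply(1)[of f X p q]
      by (auto simp: Tr_def Q_def defects_def)
    show "inj_on \<Phi> Tr"
    proof (rule inj_onI)
      fix t t' assume tt: "t \<in> Tr" "t' \<in> Tr" "\<Phi> t = \<Phi> t'"
      obtain f p q f' p' q' where t: "t = (f, p, q)" "t' = (f', p', q')"
        by (metis prod_cases3)
      have e: "switch f p q = switch f' p' q'" "p = p'" "f p = f' p'"
        using tt by (auto simp: \<Phi>_def t)
      have "f = f'" using inv(1) tt(1,2) e t by metis
      moreover have "q = q'" using inv(2) tt(1,2) e t by metis
      ultimately show "t = t'" using e t by simp
    qed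
    show "\<Phi> ` Tr \<subseteq> Im"
      by (auto simp: \<Phi>_def Tr_def Im_def Q_def defects_def)
    show "finite Im"
      unfolding Im_def using finS finX finQ by auto
  qed
  also have "card Im = (\<Sum>g\<in>S'. \<Sum>p\<in>X. card (close_points X g p))"
    unfolding Im_def using finS finX finQ by (simp add: card_SigmaI)
  also have "\<dots> \<le> (\<Sum>g\<in>S'. \<Sum>p\<in>X. d + d * d)"
    unfolding X_def by (intro sum_mono card_close_points_le)
  also have "\<dots> = card S' * (n * d * (d + d * d))"
    by (simp add: X_def card_points)
  finally show ?thesis .
qed

text \<open>The mean number of defects is bounded independently of \<open>n\<close>. For the double count any switching
  will do that keeps a parallel edge of the removed one, so only four values of \<open>q\<close> are excluded.\<close>
lemma sum_card_defects_le:
  fixes n d :: nat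
  defines "X \<equiv> points n d"
  assumes M: "8 \<le> n * d"
  shows "(\<Sum>f\<in>pairings X. card (defects X f)) \<le> 2 * (d + d * d) * card (pairings X)"
proof -
  have finX: "finite X" by (simp add: X_def)
  have "(\<Sum>f\<in>pairings X. card (defects X f)) * (n * d - 4)
      \<le> card (pairings X) * (n * d * (d + d * d))"
    unfolding X_def
  proof (rule switching_double_count, unfold X_def[symmetric])
    fix f p assume f: "f \<in> pairings X" and p: "p \<in> defects X f"
    have pX: "p \<in> X" using p by (simp add: defects_def)
    obtain r where r: "r \<in> X" "fst (f p) = fst p \<or>
        (r \<noteq> p \<and> r \<noteq> f p \<and> fst r = fst p \<and> fst (f r) = fst (f p))"
    proof (cases "fst (f p) = fst p")
      case True
      then show ?thesis using that[of p] pX by blast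
    next
      case False
      then obtain r where "r \<in> X" "r \<noteq> p" "fst r = fst p" "fst (f r) = fst (f p)"
        using p unfolding defects_def by blast
      then show ?thesis using that[of r] False by metis
    qed
    let ?Q = "{q \<in> X. q \<noteq> p \<and> q \<noteq> f p \<and> switch f p q \<in> pairings X \<and>
        f p \<in> close_points X (switch f p q) p}"
    have "X - {p, f p, r, f r} \<subseteq> ?Q"
    proof
      fix q assume q: "q \<in> X - {p, f p, r, f r}"
      note app = switch_apply[OF f pX, of q]
      have "f p \<in> close_points X (switch f p q) p"
      proof (cases "fst (f p) = fst p")
        case True
        then show ?thesis using pairingsD(1)[OF f pX] by (simp add: close_points_def)
      next
        case False
        then have r': "r \<noteq> p" "r \<noteq> f p" "fst r = fst p" "fst (f r) = fst (f p)" using r by auto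
        have "r \<noteq> f q" using q pairingsD(3)[OF f, of q] by auto
        then have "switch f p q r = f r" using app(5)[of r] q r' by auto
        then show ?thesis
          using r' r(1) pairingsD(1)[OF f pX] by (auto simp: close_points_def)
      qed
      then show "q \<in> ?Q" using q switch_pairings[OF f pX, of q] by auto
    qed
    then have "card (X - {p, f p, r, f r}) \<le> card ?Q"
      using finX by (intro card_mono) auto
    moreover have "card X - card {p, f p, r, f r} \<le> card (X - {p, f p, r, f r})"
      by (rule diff_card_le_card_Diff) simp
    moreover have "card {p, f p, r, f r} \<le> 4"
      by (simp add: card_insert_if)
    ultimately show "n * d - 4 \<le> card ?Q"
      using card_points[of n d] by (simp add: X_def)
  qed auto
  then have "(\<Sum>f\<in>pairings X. card (defects X f)) * (2 * (n * d - 4))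
      \<le> (2 * (d + d * d) * card (pairings X)) * (n * d)"
    by (simp add: algebra_simps)
  moreover have "(\<Sum>f\<in>pairings X. card (defects X f)) * (n * d)
      \<le> (\<Sum>f\<in>pairings X. card (defects X f)) * (2 * (n * d - 4))"
    by (rule mult_le_mono2) (use M in linarith)
  ultimately have "(\<Sum>f\<in>pairings X. card (defects X f)) * (n * d)
      \<le> (2 * (d + d * d) * card (pairings X)) * (n * d)"
    by linarith
  moreover have "0 < n * d" using M by linarith
  ultimately show ?thesis by (simp only: mult_le_cancel2)
qed

text \<open>If \<open>q\<close> is far from \<open>p\<close>, and \<open>f q\<close> is far from \<open>f p\<close>, neither of the new edges is a loop or is
  parallel to an old edge. They could still be parallel to each other if both old edges were
  loops, and this is why \<open>q\<close> must not be a defect.\<close>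
lemma switch_defects_subset:
  assumes f: "f \<in> pairings X" and p: "p \<in> defects X f" and q: "q \<in> X"
    and far: "q \<notin> close_points X f p" "f q \<notin> close_points X f (f p)" and good: "q \<notin> defects X f"
  shows "defects X (switch f p q) \<subseteq> defects X f - {p}"
    and "f p \<in> close_points X (switch f p q) p"
    and "q \<noteq> p" "q \<noteq> f p"
proof -
  let ?g = "switch f p q"
  have pX: "p \<in> X" using p by (simp add: defects_def)
  have fX: "f p \<in> X" "f q \<in> X" using pX q pairingsD(1)[OF f] by auto
  have far1: "fst q \<noteq> fst p" "\<And>r. r \<in> X \<Longrightarrow> fst r = fst p \<Longrightarrow> fst (f r) \<noteq> fst q"
    using far(1) q by (auto simp: close_points_def)
  have far2: "fst (f q) \<noteq> fst (f p)" "\<And>r. r \<in> X \<Longrightarrow> fst r = fst (f p) \<Longrightarrow> fst (f r) \<noteq> fst (f q)"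
    using far(2) fX by (auto simp: close_points_def)
  have noloop: "fst (f q) \<noteq> fst q" using good q by (auto simp: defects_def)
  show ne: "q \<noteq> p" "q \<noteq> f p" using far1(1) far1(2)[OF pX] by auto
  note app = switch_apply[OF f pX q ne]
  have g: "?g \<in> pairings X" by (rule switch_pairings[OF f pX q ne])
  have "p \<notin> defects X ?g"
  proof
    assume "p \<in> defects X ?g"
    then obtain z where z: "z \<in> X" "z \<noteq> p" "fst z = fst p" "fst (?g z) = fst q"
      using far1(1) app(1) by (auto simp: defects_def)
    show False
    proof (cases "z \<in> {p, q, f p, f q}")
      case True
      then show False using z far1(1) far1(2)[OF pX] noloop app by auto
    next
      case False
      then show False using z far1(2)[of z] app(5)[of z] by auto
    qed
  qed
  moreover have "f p \<notin> defects X ?g"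
  proof
    assume "f p \<in> defects X ?g"
    then obtain z where z: "z \<in> X" "z \<noteq> f p" "fst z = fst (f p)" "fst (?g z) = fst (f q)"
      using far2(1) app(3) by (auto simp: defects_def)
    show False
    proof (cases "z \<in> {p, q, f p, f q}")
      case True
      then show False using z far1(1) far1(2)[OF pX] far2(1) noloop app by auto
    next
      case False
      then show False using z far2(2)[of z] app(5)[of z] by auto
    qed
  qed
  ultimately have four: "z \<notin> defects X ?g" if "z \<in> {p, q, f p, f q}" for z
    using that defects_partner[OF g] app by fastforce
  show "defects X ?g \<subseteq> defects X f - {p}"
  proof
    fix y assume y: "y \<in> defects X ?g"
    have yX: "y \<in> X" using y by (simp add: defects_def)
    have yn: "y \<notin> {p, q, f p, f q}" using four y by blast
    have gy: "?g y = f y" by (rule app(5)[OF yn])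
    have "y \<in> defects X f"
    proof (cases "fst (?g y) = fst y")
      case True
      then show ?thesis using yX gy by (simp add: defects_def)
    next
      case False
      then obtain z where z: "z \<in> X" "z \<noteq> y" "fst z = fst y" "fst (?g z) = fst (?g y)"
        using y by (auto simp: defects_def)
      then have "z \<in> defects X ?g" using yX by (auto simp: defects_def)
      then have "?g z = f z" using four app(5) by blast
      then show ?thesis using z gy yX by (auto simp: defects_def)
    qed
    then show "y \<in> defects X f - {p}" using yn by auto
  qed
  show "f p \<in> close_points X ?g p"
  proof (cases "fst (f p) = fst p")
    case True
    then show ?thesis using fX by (simp add: close_points_def)
  next
    case False
    then obtain r where r: "r \<in> X" "r \<noteq> p" "fst r = fst p" "fst (f r) = fst (f p)"
      using p by (auto simp: defects_def)
    have "r \<noteq> q" using r far1(1) by auto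
    moreover have "r \<noteq> f p" using r False by auto
    moreover have "r \<noteq> f q" using r far1(2)[of r] pairingsD(3)[OF f, of q] by auto
    ultimately have "?g r = f r" using app(5)[of r] r by auto
    then show ?thesis using r fX by (auto simp: close_points_def)
  qed
qed

text \<open>All but \<open>2(d + d\<^sup>2) + k\<close> choices of \<open>q\<close> lead to fewer defects, and for large \<open>n\<close> these are at
  least half of all \<open>n d\<close> points.\<close>
lemma card_pairings_defects_eq_le:
  fixes n d k :: nat
  defines "X \<equiv> points n d"
  assumes k: "0 < k" and M: "2 * (2 * (d + d * d) + k) \<le> n * d"
  shows "card {f \<in> pairings X. card (defects X f) = k}
           \<le> 2 * (d + d * d) * card {f \<in> pairings X. card (defects X f) < k}"
proof -
  have finX: "finite X" by (simp add: X_def)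
  define D where "D = d + d * d"
  define N where "N = n * d - (2 * D + k)"
  let ?S = "{f \<in> pairings X. card (defects X f) = k}"
  let ?S' = "{f \<in> pairings X. card (defects X f) < k}"
  have "(\<Sum>f\<in>?S. card (defects X f)) * N \<le> card ?S' * (n * d * (d + d * d))"
    unfolding X_def
  proof (rule switching_double_count, unfold X_def[symmetric])
    fix f p assume fS: "f \<in> ?S" and p: "p \<in> defects X f"
    have f: "f \<in> pairings X" using fS by simp
    have pX: "p \<in> X" using p by (simp add: defects_def)
    let ?Q = "{q \<in> X. q \<noteq> p \<and> q \<noteq> f p \<and> switch f p q \<in> ?S' \<and>
        f p \<in> close_points X (switch f p q) p}"
    \<comment> \<open>these exclude \<open>q = p\<close> and \<open>q = f p\<close> as well, since \<open>p\<close> and \<open>f p\<close> are close to \<open>p\<close>\<close>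
    let ?E1 = "close_points X f p"
    let ?E2 = "f ` close_points X f (f p)"
    have "X - (?E1 \<union> ?E2 \<union> defects X f) \<subseteq> ?Q"
    proof
      fix q assume q: "q \<in> X - (?E1 \<union> ?E2 \<union> defects X f)"
      have "f q \<notin> close_points X f (f p)"
        using q pairingsD(3)[OF f, of q] by (auto simp: image_iff)
      note sw = switch_defects_subset[OF f p _ _ this]
      have sub: "defects X (switch f p q) \<subset> defects X f"
        using sw(1) q p by blast
      have "card (defects X (switch f p q)) < card (defects X f)"
        using finX by (intro psubset_card_mono sub) simp
      moreover have "q \<noteq> p" "q \<noteq> f p" using sw(3,4) q by auto
      moreover have "switch f p q \<in> pairings X"
        using switch_pairings[OF f pX] q \<open>q \<noteq> p\<close> \<open>q \<noteq> f p\<close> by auto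
      moreover have "f p \<in> close_points X (switch f p q) p"
        using sw(2) q by auto
      ultimately show "q \<in> ?Q" using q fS by auto
    qed
    then have "card (X - (?E1 \<union> ?E2 \<union> defects X f)) \<le> card ?Q"
      using finX by (intro card_mono) auto
    moreover have "card X - card (?E1 \<union> ?E2 \<union> defects X f) \<le> card (X - (?E1 \<union> ?E2 \<union> defects X f))"
      using finX by (intro diff_card_le_card_Diff) (simp add: close_points_def)
    moreover have "card (?E1 \<union> ?E2 \<union> defects X f) \<le> 2 * D + k"
    proof -
      have "card ?E1 \<le> D"
        unfolding X_def D_def by (rule card_close_points_le)
      moreover have "card ?E2 \<le> D"
      proof -
        have "card ?E2 \<le> card (close_points X f (f p))"
          using finX by (intro card_image_le) (simp add: close_points_def)
        also have "\<dots> \<le> D"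
          unfolding X_def D_def by (rule card_close_points_le)
        finally show ?thesis .
      qed
      moreover have "card (defects X f) = k" using fS by simp
      moreover have "card (?E1 \<union> ?E2 \<union> defects X f) \<le> card ?E1 + card ?E2 + card (defects X f)"
        by (meson add_le_mono card_Un_le order_trans le_refl)
      ultimately show ?thesis by linarith
    qed
    moreover have "card X = n * d" unfolding X_def by (rule card_points)
    ultimately show "N \<le> card ?Q" unfolding N_def by linarith
  qed auto
  then have "card ?S * k * N \<le> card ?S' * D * (n * d)"
    by (simp add: D_def algebra_simps)
  moreover have "card ?S * 1 * N \<le> card ?S * k * N"
    using k by (intro mult_le_mono) auto
  ultimately have "card ?S * N \<le> card ?S' * D * (n * d)" by linarith
  then have "card ?S * (2 * N) \<le> (2 * D * card ?S') * (n * d)"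
    by (simp add: algebra_simps)
  moreover have "card ?S * (n * d) \<le> card ?S * (2 * N)"
  proof (rule mult_le_mono2)
    obtain j where "n * d = 2 * (2 * D + k) + j"
      using M le_Suc_ex unfolding D_def by blast
    then show "n * d \<le> 2 * N" by (simp add: N_def)
  qed
  ultimately have "card ?S * (n * d) \<le> (2 * D * card ?S') * (n * d)"
    by linarith
  moreover have "0 < n * d"
    by (rule less_le_trans[OF _ M]) (use k in simp)
  ultimately show ?thesis unfolding D_def by simp
qed

text \<open>By Markov's inequality at least half of the pairings have at most \<open>4 D\<close> defects, and from there
  a bounded number of switching steps leads to a pairing without defects, each at the cost of a
  factor \<open>1 + 2 D\<close>.\<close>
lemma card_pairings_le_card_simple:
  fixes n d :: nat
  defines "X \<equiv> points n d" and "D \<equiv> d + d * d"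
  assumes d: "0 < d" and M: "12 * D \<le> n * d"
  shows "card (pairings X) \<le> 2 * (1 + 2 * D) ^ (4 * D) * card {f \<in> pairings X. defects X f = {}}"
proof -
  have finX: "finite X" by (simp add: X_def)
  note finP = finite_pairings[OF finX]
  \<comment> \<open>twice the bound for the mean number of defects\<close>
  define K where "K = 4 * D"
  define t where "t k = card {f \<in> pairings X. card (defects X f) \<le> k}" for k
  have t_le: "t k \<le> (1 + 2 * D) ^ k * t 0" if "k \<le> K" for k
    using that
  proof (induction k)
    case (Suc k)
    have "t (Suc k) \<le> t k + card {f \<in> pairings X. card (defects X f) = Suc k}"
      unfolding t_def
      by (rule order_trans[OF card_mono card_Un_le]) (use finP in \<open>auto simp: le_Suc_eq\<close>)
    also have "card {f \<in> pairings X. card (defects X f) = Suc k} \<le> 2 * D * t k"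
      using card_pairings_defects_eq_le[of "Suc k" d n] Suc.prems M
      by (simp add: t_def X_def D_def K_def less_Suc_eq_le)
    finally have "t (Suc k) \<le> (1 + 2 * D) * t k" by simp
    also have "\<dots> \<le> (1 + 2 * D) * ((1 + 2 * D) ^ k * t 0)"
      using Suc by (intro mult_le_mono2) simp
    finally show ?case by (simp only: power_Suc mult.assoc)
  qed simp
  have Dpos: "0 < D" using d by (simp add: D_def)
  define h where "h = card {f \<in> pairings X. K < card (defects X f)}"
  have "h * K = (\<Sum>f\<in>{f \<in> pairings X. K < card (defects X f)}. K)"
    by (simp add: h_def)
  also have "\<dots> \<le> (\<Sum>f\<in>{f \<in> pairings X. K < card (defects X f)}. card (defects X f))"
    by (intro sum_mono) auto
  also have "\<dots> \<le> (\<Sum>f\<in>pairings X. card (defects X f))"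
    using finP by (intro sum_mono2) auto
  also have "\<dots> \<le> 2 * D * card (pairings X)"
    unfolding X_def D_def by (rule sum_card_defects_le) (use M Dpos in linarith)
  finally have "2 * h \<le> card (pairings X)"
    using Dpos by (simp add: K_def)
  moreover have "card (pairings X) \<le> t K + h"
    unfolding t_def h_def
    by (rule order_trans[OF card_mono card_Un_le]) (use finP in auto)
  ultimately have "card (pairings X) \<le> 2 * t K" by linarith
  also have "\<dots> \<le> 2 * ((1 + 2 * D) ^ K * t 0)"
    using t_le[of K] by simp
  also have "t 0 = card {f \<in> pairings X. defects X f = {}}"
    using finX by (simp add: t_def)
  finally show ?thesis by (simp add: K_def mult.assoc)
qed

section \<open>From pairings to regular graphs\<close>

definition pairing_graph :: "('v \<times> 'i) set \<Rightarrow> ('v \<times> 'i \<Rightarrow> 'v \<times> 'i) \<Rightarrow> 'v set set" where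
  "pairing_graph X f = (\<lambda>p. {fst p, fst (f p)}) ` X"

definition simple_pairings :: "nat \<Rightarrow> nat \<Rightarrow> (nat \<times> nat \<Rightarrow> nat \<times> nat) set" where
  "simple_pairings n d = {f \<in> pairings (points n d). defects (points n d) f = {}}"

lemma simple_pairingsD:
  assumes "f \<in> simple_pairings n d"
  shows "f \<in> pairings (points n d)"
    "p \<in> points n d \<Longrightarrow> fst (f p) \<noteq> fst p"
    "p \<in> points n d \<Longrightarrow> r \<in> points n d \<Longrightarrow> fst r = fst p \<Longrightarrow> fst (f r) = fst (f p) \<Longrightarrow> r = p"
  using assms unfolding simple_pairings_def defects_def by blast+

lemma finite_simple_pairings: "finite (simple_pairings n d)"
  unfolding simple_pairings_def by (simp add: finite_pairings)

lemma edge_pairing_graph_iff: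
  assumes f: "f \<in> pairings X"
  shows "{v, w} \<in> pairing_graph X f \<longleftrightarrow> (\<exists>p\<in>X. fst p = v \<and> fst (f p) = w)"
proof
  assume "{v, w} \<in> pairing_graph X f"
  then obtain p where p: "p \<in> X" "{v, w} = {fst p, fst (f p)}"
    by (auto simp: pairing_graph_def)
  have "f p \<in> X" "f (f p) = p" using pairingsD[OF f] p by auto
  then show "\<exists>p\<in>X. fst p = v \<and> fst (f p) = w"
    using p by (auto simp: doubleton_eq_iff intro: bexI[of _ p] bexI[of _ "f p"])
qed (auto simp: pairing_graph_def)

lemma card_incident_edges:
  assumes "simple_graph V E"
  shows "card {e \<in> E. v \<in> e} = card {w. {v, w} \<in> E}"
proof -
  have "{e \<in> E. v \<in> e} = (\<lambda>w. {v, w}) ` {w. {v, w} \<in> E}"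
  proof
    show "{e \<in> E. v \<in> e} \<subseteq> (\<lambda>w. {v, w}) ` {w. {v, w} \<in> E}"
    proof clarify
      fix e assume e: "e \<in> E" "v \<in> e"
      then have "card e = 2" using assms by (auto simp: simple_graph_def)
      then obtain a b where "e = {a, b}" by (auto simp: card_2_iff)
      then have "e = {v, a} \<or> e = {v, b}" using e by auto
      then show "e \<in> (\<lambda>w. {v, w}) ` {w. {v, w} \<in> E}" using e by auto
    qed
  qed auto
  moreover have "inj_on (\<lambda>w. {v, w}) {w. {v, w} \<in> E}"
    by (auto simp: inj_on_def doubleton_eq_iff)
  ultimately show ?thesis by (simp add: card_image)
qed

lemma regular_graphsD:
  assumes "E \<in> regular_graphs n d"
  shows "v < n \<Longrightarrow> card {w. {v, w} \<in> E} = d"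
    "{v, w} \<in> E \<Longrightarrow> v < n \<and> w < n \<and> v \<noteq> w"
    "e \<in> E \<Longrightarrow> \<exists>v w. e = {v, w}"
proof -
  have E: "simple_graph {..<n} E" using assms by (simp add: regular_graphs_def)
  show "v < n \<Longrightarrow> card {w. {v, w} \<in> E} = d"
    using card_incident_edges[OF E, of v] assms by (simp add: regular_graphs_def)
  show "{v, w} \<in> E \<Longrightarrow> v < n \<and> w < n \<and> v \<noteq> w"
    using E by (auto simp: simple_graph_def card_insert_if split: if_splits)
  show "e \<in> E \<Longrightarrow> \<exists>v w. e = {v, w}"
    using E unfolding simple_graph_def card_2_iff by blast
qed

lemma finite_regular_graphs: "finite (regular_graphs n d)"
proof (rule finite_subset)
  show "regular_graphs n d \<subseteq> Pow (Pow {..<n})"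
    by (auto simp: regular_graphs_def simple_graph_def)
qed simp

lemma pairing_graph_regular:
  assumes f: "f \<in> simple_pairings n d"
  shows "pairing_graph (points n d) f \<in> regular_graphs n d"
proof -
  let ?X = "points n d"
  let ?E = "pairing_graph ?X f"
  note P = simple_pairingsD(1)[OF f]
  have E: "simple_graph {..<n} ?E"
  proof -
    have "e \<subseteq> {..<n} \<and> card e = 2" if e: "e \<in> ?E" for e
    proof -
      obtain p where p: "p \<in> ?X" "e = {fst p, fst (f p)}"
        using e unfolding pairing_graph_def by blast
      then have "f p \<in> ?X" "fst (f p) \<noteq> fst p"
        using pairingsD(1)[OF P] simple_pairingsD(2)[OF f] by auto
      then show ?thesis using p by (auto simp: points_def card_insert_if)
    qed
    then show ?thesis by (auto simp: simple_graph_def)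
  qed
  have "card {w. {v, w} \<in> ?E} = d" if v: "v < n" for v
  proof -
    have "{w. {v, w} \<in> ?E} = (\<lambda>i. fst (f (v, i))) ` {..<d}"
      unfolding edge_pairing_graph_iff[OF P] using v by (auto simp: points_def)
    moreover have "inj_on (\<lambda>i. fst (f (v, i))) {..<d}"
      using simple_pairingsD(3)[OF f] v by (auto simp: inj_on_def points_def)
    ultimately show ?thesis by (simp add: card_image)
  qed
  then show ?thesis
    using E by (simp add: regular_graphs_def card_incident_edges[OF E])
qed

definition injections :: "'a set \<Rightarrow> 'b set \<Rightarrow> ('a \<Rightarrow> 'b) set" where
  "injections A B = {g \<in> A \<rightarrow>\<^sub>E B. inj_on g A}"

lemma card_injections_cong:
  assumes "finite B" "finite C" "card B = card C"
  shows "card (injections A B) = card (injections A C)"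
proof -
  obtain h where h: "bij_betw h B C"
    using assms finite_same_card_bij by blast
  define k where "k = inv_into B h"
  have kh: "\<And>b. b \<in> B \<Longrightarrow> k (h b) = b" "\<And>c. c \<in> C \<Longrightarrow> h (k c) = c"
    "\<And>b. b \<in> B \<Longrightarrow> h b \<in> C" "\<And>c. c \<in> C \<Longrightarrow> k c \<in> B"
    using h unfolding k_def bij_betw_def by (auto simp: inv_into_f_f f_inv_into_f inv_into_into)
  have "bij_betw (\<lambda>g. \<lambda>x\<in>A. h (g x)) (injections A B) (injections A C)"
  proof (rule bij_betw_byWitness[where f' = "\<lambda>g. \<lambda>x\<in>A. k (g x)"])
    show "\<forall>g\<in>injections A B. (\<lambda>x\<in>A. k ((\<lambda>x\<in>A. h (g x)) x)) = g"
      by (auto simp: injections_def fun_eq_iff kh PiE_iff extensional_def)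
    show "\<forall>g\<in>injections A C. (\<lambda>x\<in>A. h ((\<lambda>x\<in>A. k (g x)) x)) = g"
      by (auto simp: injections_def fun_eq_iff kh PiE_iff extensional_def)
    show "(\<lambda>g. \<lambda>x\<in>A. h (g x)) ` injections A B \<subseteq> injections A C"
      by (auto simp: injections_def kh PiE_iff inj_on_def) (metis kh(1))
    show "(\<lambda>g. \<lambda>x\<in>A. k (g x)) ` injections A C \<subseteq> injections A B"
      by (auto simp: injections_def kh PiE_iff inj_on_def) (metis kh(2))
  qed
  then show ?thesis by (rule bij_betw_same_card)
qed

text \<open>A pairing with graph \<open>E\<close> amounts to a numbering of the neighbours of every vertex \<open>v\<close>: the point
  \<open>(v, i)\<close> belongs to the edge from \<open>v\<close> to its \<open>i\<close>-th neighbour \<open>w\<close>, and its partner is the point of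
  \<open>w\<close> whose number stands for \<open>v\<close>. Hence the number of these pairings is the same for all \<open>E\<close>.\<close>
lemma card_simple_pairings_of_graph:
  assumes E: "E \<in> regular_graphs n d"
  shows "card {f \<in> simple_pairings n d. pairing_graph (points n d) f = E}
           = card (injections {..<d} {..<d}) ^ n"
proof -
  let ?X = "points n d"
  define N where "N v = {w. {v, w} \<in> E}" for v
  define F where "F = {f \<in> simple_pairings n d. pairing_graph ?X f = E}"
  define T where "T = (\<Pi>\<^sub>E v\<in>{..<n}. injections {..<d} (N v))"
  define \<Phi> :: "(nat \<times> nat \<Rightarrow> nat \<times> nat) \<Rightarrow> nat \<Rightarrow> nat \<Rightarrow> nat"
    where "\<Phi> f = (\<lambda>v\<in>{..<n}. \<lambda>i\<in>{..<d}. fst (f (v, i)))" for f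
  have finN: "finite (N v)" for v
    using regular_graphsD(2)[OF E] unfolding N_def
    by (auto intro: finite_subset[where B = "{..<n}"])
  have cardN: "card (N v) = d" if "v < n" for v
    using regular_graphsD(1)[OF E that] by (simp add: N_def)
  have N_sym: "w \<in> N v \<longleftrightarrow> v \<in> N w" for v w
    by (simp add: N_def insert_commute)
  have N_lt: "w < n" "w \<noteq> v" if "w \<in> N v" for v w
    using that regular_graphsD(2)[OF E, of v w] by (auto simp: N_def)
  have "bij_betw \<Phi> F T"
    unfolding bij_betw_def
  proof
    show "inj_on \<Phi> F"
    proof (rule inj_onI, rule ext)
      fix f f' p assume F: "f \<in> F" "f' \<in> F" and eq: "\<Phi> f = \<Phi> f'"
      have S: "f \<in> simple_pairings n d" "f' \<in> simple_pairings n d" using F by (auto simp: F_def)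
      note P = simple_pairingsD(1)[OF S(1)] simple_pairingsD(1)[OF S(2)]
      have fst_eq: "fst (f q) = fst (f' q)" if q: "q \<in> ?X" for q
      proof -
        obtain v i where "q = (v, i)" "v < n" "i < d"
          using q by (auto simp: points_def)
        then show ?thesis using fun_cong[OF fun_cong[OF eq], of v i] by (simp add: \<Phi>_def)
      qed
      show "f p = f' p"
      proof (cases "p \<in> ?X")
        case True
        have X: "f p \<in> ?X" "f' p \<in> ?X" using True pairingsD(1)[OF P(1)] pairingsD(1)[OF P(2)] by auto
        have "fst (f' (f' p)) = fst (f (f p))"
          by (simp add: pairingsD(3)[OF P(1)] pairingsD(3)[OF P(2)])
        then have "fst (f (f' p)) = fst (f (f p))"
          using fst_eq[OF X(2)] by simp
        then show ?thesis
          using simple_pairingsD(3)[OF S(1) X] fst_eq[OF True] by simp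
      qed (simp add: pairingsD(4)[OF P(1)] pairingsD(4)[OF P(2)])
    qed
    show "\<Phi> ` F = T"
    proof
      show "\<Phi> ` F \<subseteq> T"
      proof clarify
        fix f assume f: "f \<in> F"
        then have S: "f \<in> simple_pairings n d" and g: "pairing_graph ?X f = E"
          by (auto simp: F_def)
        have "fst (f (v, i)) \<in> N v" if "v < n" "i < d" for v i
          unfolding N_def g[symmetric] mem_Collect_eq edge_pairing_graph_iff[OF simple_pairingsD(1)[OF S]]
          using that by (intro bexI[of _ "(v, i)"]) (auto simp: points_def)
        moreover have "inj_on (\<lambda>i\<in>{..<d}. fst (f (v, i))) {..<d}" if "v < n" for v
          using simple_pairingsD(3)[OF S] that by (auto simp: inj_on_def points_def)
        ultimately show "\<Phi> f \<in> T"
          by (auto simp: T_def \<Phi>_def injections_def)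
      qed
      show "T \<subseteq> \<Phi> ` F"
      proof
        fix \<phi> assume \<phi>: "\<phi> \<in> T"
        have undef: "\<phi> v = undefined" if "\<not> v < n" for v
          using \<phi> that by (auto simp: T_def PiE_iff extensional_def)
        have inj: "\<phi> v \<in> injections {..<d} (N v)" if "v < n" for v
          using \<phi> that by (auto simp: T_def)
        have bij: "bij_betw (\<phi> v) {..<d} (N v)" if "v < n" for v
        proof -
          have "\<phi> v ` {..<d} \<subseteq> N v" "inj_on (\<phi> v) {..<d}"
            using inj[OF that] by (auto simp: injections_def)
          moreover from this have "card (\<phi> v ` {..<d}) = card (N v)"
            using cardN[OF that] by (simp add: card_image)
          ultimately show ?thesis
            using finN card_subset_eq unfolding bij_betw_def by blast
        qed
        define f where "f p = (if p \<in> ?X then (let w = \<phi> (fst p) (snd p) in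
            (w, inv_into {..<d} (\<phi> w) (fst p))) else p)" for p
        have key: "\<exists>w j. f (v, i) = (w, j) \<and> w = \<phi> v i \<and> w \<in> N v \<and> w < n \<and> j < d \<and> \<phi> w j = v"
          if "v < n" "i < d" for v i
        proof -
          have w: "\<phi> v i \<in> N v" using bij_betwE[OF bij[OF that(1)]] that(2) by auto
          then have "\<phi> v i < n" "v \<in> N (\<phi> v i)" using N_lt N_sym by auto
          moreover from this have "v \<in> \<phi> (\<phi> v i) ` {..<d}"
            using bij unfolding bij_betw_def by blast
          ultimately show ?thesis
            using w that inv_into_into[of v "\<phi> (\<phi> v i)" "{..<d}"]
              f_inv_into_f[of v "\<phi> (\<phi> v i)" "{..<d}"]
            by (auto simp: f_def points_def Let_def)
        qed
        have fst_f: "fst (f (v, i)) = \<phi> v i" if "v < n" "i < d" for v i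
          using key[OF that] by auto
        have P: "f \<in> pairings ?X"
        proof -
          have "f p \<in> ?X \<and> f p \<noteq> p \<and> f (f p) = p" if pX: "p \<in> ?X" for p
          proof -
            obtain v i where p: "p = (v, i)" "v < n" "i < d"
              using pX by (auto simp: points_def)
            obtain w j where 1: "f (v, i) = (w, j)" "w = \<phi> v i" "w \<in> N v" "w < n" "j < d" "\<phi> w j = v"
              using key[OF p(2,3)] by blast
            obtain v' i' where 2: "f (w, j) = (v', i')" "v' = \<phi> w j" "i' < d" "\<phi> v' i' = w"
              using key[OF 1(4,5)] by blast
            have "v' = v" using 1 2 by simp
            moreover from this have "i' = i"
              using bij[OF p(2)] 1 2 p(3) by (auto simp: bij_betw_def inj_on_def)
            ultimately show ?thesis using 1 2 p N_lt(2)[OF 1(3)] by (simp add: points_def)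
          qed
          moreover have "f p = p" if "p \<notin> ?X" for p
            using that by (simp add: f_def)
          ultimately show ?thesis unfolding pairings_def by blast
        qed
        have "defects ?X f = {}"
        proof -
          have "p \<notin> defects ?X f" for p
          proof
            assume p: "p \<in> defects ?X f"
            then obtain v i where vi: "p = (v, i)" "v < n" "i < d"
              by (auto simp: points_def defects_def)
            have "fst (f p) \<noteq> fst p" using key[OF vi(2,3)] N_lt(2) vi(1) by auto
            then obtain r where r: "r \<in> ?X" "r \<noteq> p" "fst r = fst p" "fst (f r) = fst (f p)"
              using p by (auto simp: defects_def)
            then obtain i' where "r = (v, i')" "i' < d" using vi by (cases r) (auto simp: points_def)
            then show False
              using r vi fst_f bij[OF vi(2)] by (auto simp: bij_betw_def inj_on_def)
          qed
          then show ?thesis by blast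
        qed
        then have S: "f \<in> simple_pairings n d" using P by (simp add: simple_pairings_def)
        have "{v, w} \<in> pairing_graph ?X f \<longleftrightarrow> {v, w} \<in> E" for v w
        proof -
          have "{v, w} \<in> pairing_graph ?X f \<longleftrightarrow> (\<exists>i<d. v < n \<and> \<phi> v i = w)"
            unfolding edge_pairing_graph_iff[OF P] using fst_f by (auto simp: points_def)
          also have "\<dots> \<longleftrightarrow> v < n \<and> w \<in> \<phi> v ` {..<d}" by auto
          also have "\<dots> \<longleftrightarrow> v < n \<and> w \<in> N v" using bij unfolding bij_betw_def by auto
          also have "\<dots> \<longleftrightarrow> {v, w} \<in> E" using regular_graphsD(2)[OF E] by (auto simp: N_def)
          finally show ?thesis .
        qed
        moreover have "\<exists>v w. e = {v, w}" if "e \<in> pairing_graph ?X f" for e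
          using that unfolding pairing_graph_def by blast
        ultimately have "pairing_graph ?X f = E"
          using regular_graphsD(3)[OF E] by (intro set_eqI) metis
        then have "f \<in> F" using S by (simp add: F_def)
        moreover have "\<Phi> f = \<phi>"
        proof (intro ext)
          fix v i
          show "\<Phi> f v i = \<phi> v i"
          proof (cases "v < n")
            case True
            then show ?thesis
              using inj[OF True] fst_f[OF True]
              by (auto simp: \<Phi>_def injections_def PiE_iff extensional_def)
          qed (simp add: \<Phi>_def undef)
        qed
        ultimately show "\<phi> \<in> \<Phi> ` F" by blast
      qed
    qed
  qed
  then have "card F = card T" by (rule bij_betw_same_card)
  also have "card T = (\<Prod>v<n. card (injections {..<d} (N v)))"
    unfolding T_def by (rule card_PiE) simp
  also have "\<dots> = (\<Prod>v<n. card (injections {..<d} {..<d}))"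
    by (intro prod.cong refl card_injections_cong finN) (simp_all add: cardN)
  finally show ?thesis by (simp add: F_def)
qed

lemma card_simple_pairings_graph_property:
  "card {f \<in> simple_pairings n d. Q (pairing_graph (points n d) f)}
     = card {E \<in> regular_graphs n d. Q E} * card (injections {..<d} {..<d}) ^ n"
proof -
  let ?fib = "\<lambda>E. {f \<in> simple_pairings n d. pairing_graph (points n d) f = E}"
  have "{f \<in> simple_pairings n d. Q (pairing_graph (points n d) f)}
      = (\<Union>E\<in>{E \<in> regular_graphs n d. Q E}. ?fib E)"
    using pairing_graph_regular by auto
  also have "card \<dots> = (\<Sum>E\<in>{E \<in> regular_graphs n d. Q E}. card (?fib E))"
    by (rule card_UN_disjoint)
       (use finite_regular_graphs[of n d] finite_simple_pairings[of n d] in auto)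
  also have "\<dots> = (\<Sum>E\<in>{E \<in> regular_graphs n d. Q E}. card (injections {..<d} {..<d}) ^ n)"
    by (intro sum.cong refl card_simple_pairings_of_graph) simp
  finally show ?thesis by simp
qed

text \<open>All fibres over regular graphs have the same size, so the probability of \<open>Q\<close> among graphs is its
  probability among simple pairings, and this exceeds the one among all pairings by at most the
  factor from \<open>card_pairings_le_card_simple\<close>.\<close>
lemma prob_random_regular_graph_le:
  fixes n d :: nat and \<beta> :: real
  defines "D \<equiv> d + d * d"
  assumes d: "0 < d" and M: "12 * D \<le> n * d" and even: "even (n * d)"
    and \<beta>: "card {f \<in> simple_pairings n d. Q (pairing_graph (points n d) f)}
              \<le> \<beta> * pairing_count (n * d)"
  shows "measure_pmf.prob (random_regular_graph n d) {E. Q E} \<le> 2 * (1 + 2 * D) ^ (4 * D) * \<beta>"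
proof -
  define c where "c = card (injections {..<d} {..<d}) ^ n"
  define R where "R = regular_graphs n d"
  define K where "K = 2 * (1 + 2 * D) ^ (4 * D)"
  have count: "card (pairings (points n d)) = pairing_count (n * d)"
    by (simp add: card_pairings card_points)
  have le: "pairing_count (n * d) \<le> K * (card R * c)"
    using card_pairings_le_card_simple[of d n] d M
      card_simple_pairings_graph_property[of n d "\<lambda>_. True"]
    by (simp add: count D_def K_def R_def c_def simple_pairings_def)
  have pos: "0 < pairing_count (n * d)" using even by (rule pairing_count_pos)
  then have Rc: "0 < card R" "0 < c" using le by (auto intro!: Nat.gr0I)
  have "R \<noteq> {}" using Rc(1) by auto
  then have "measure_pmf.prob (random_regular_graph n d) {E. Q E} = card (R \<inter> {E. Q E}) / card R"
    unfolding random_regular_graph_def R_def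
    by (intro measure_pmf_of_set finite_regular_graphs)
  moreover have "R \<inter> {E. Q E} = {E \<in> R. Q E}" by auto
  moreover have "real (card {E \<in> R. Q E}) \<le> (K * \<beta>) * card R"
  proof -
    have b: "real (card {E \<in> R. Q E}) * c \<le> \<beta> * pairing_count (n * d)"
      using \<beta> unfolding card_simple_pairings_graph_property by (simp add: R_def c_def)
    have "0 \<le> \<beta> * pairing_count (n * d)"
      by (rule order_trans[OF _ b]) simp
    then have "0 \<le> \<beta>" using pos by (simp add: zero_le_mult_iff)
    then have "\<beta> * pairing_count (n * d) \<le> \<beta> * (K * (card R * c))"
      using le by (intro mult_left_mono) (simp_all only: of_nat_le_iff)
    then have "real (card {E \<in> R. Q E}) * c \<le> ((K * \<beta>) * card R) * c"
      using b by (simp add: algebra_simps)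
    then show ?thesis using Rc(2) by simp
  qed
  ultimately show ?thesis
    using Rc(1) by (simp add: divide_le_eq K_def)
qed

section \<open>The expected number of sets with few neighbours\<close>

lemma card_pairings_no_edges_between_le:
  fixes L :: real
  assumes AB: "A \<subseteq> {..<n}" "B \<subseteq> {..<n}" "A \<inter> B = {}"
    and L: "0 \<le> L" "L \<le> 1" and key: "card B * L + card A \<le> n * L\<^sup>2"
  shows "card {f \<in> pairings (points n d).
             \<forall>v\<in>A. \<forall>w\<in>{..<n} - A - B. {v, w} \<notin> pairing_graph (points n d) f}
           \<le> pairing_count (n * d) * L ^ (d * card A)"
proof -
  let ?X = "points n d"
  define C where "C = {..<n} - A - B"
  have fin: "finite A" "finite B" "finite C"
    using AB finite_subset[of _ "{..<n}"] by (simp_all add: C_def)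
  define P where "P S = S \<times> {..<d}" for S :: "nat set"
  have X: "?X = P A \<union> P B \<union> P C"
    using AB unfolding points_def P_def C_def by auto
  have cardP: "card (P S) = card S * d" for S
    by (simp add: P_def card_cartesian_product)
  have "{..<n} = A \<union> B \<union> C" using AB by (auto simp: C_def)
  then have "card (A \<union> B \<union> C) = n" by (metis card_lessThan)
  moreover have "card (A \<union> B \<union> C) = card A + card B + card C"
  proof -
    have "(A \<union> B) \<inter> C = {}" by (auto simp: C_def)
    then show ?thesis using fin AB(3) by (simp add: card_Un_disjoint)
  qed
  ultimately have n: "card A + card B + card C = n" by simp
  have n': "card (P A) + card (P B) + card (P C) = n * d"
    using n unfolding cardP by (simp only: add_mult_distrib[symmetric])
  have "{f \<in> pairings ?X. \<forall>v\<in>A. \<forall>w\<in>C. {v, w} \<notin> pairing_graph ?X f}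
      \<subseteq> {f \<in> pairings (P A \<union> P B \<union> P C). \<forall>x\<in>P A. f x \<notin> P C}"
  proof
    fix f assume "f \<in> {f \<in> pairings ?X. \<forall>v\<in>A. \<forall>w\<in>C. {v, w} \<notin> pairing_graph ?X f}"
    then have f: "f \<in> pairings ?X" and no: "\<forall>v\<in>A. \<forall>w\<in>C. {v, w} \<notin> pairing_graph ?X f"
      by simp_all
    have "f x \<notin> P C" if x: "x \<in> P A" for x
    proof
      assume "f x \<in> P C"
      then have "fst (f x) \<in> C" "fst x \<in> A" using x unfolding P_def by (simp_all add: mem_Times_iff)
      moreover have "x \<in> ?X" using x X by blast
      then have "{fst x, fst (f x)} \<in> pairing_graph ?X f" unfolding pairing_graph_def by blast
      ultimately show False using no by blast
    qed
    then show "f \<in> {f \<in> pairings (P A \<union> P B \<union> P C). \<forall>x\<in>P A. f x \<notin> P C}"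
      using f unfolding X by blast
  qed
  then have "card {f \<in> pairings ?X. \<forall>v\<in>A. \<forall>w\<in>C. {v, w} \<notin> pairing_graph ?X f}
      \<le> card {f \<in> pairings (P A \<union> P B \<union> P C). \<forall>x\<in>P A. f x \<notin> P C}"
    by (intro card_mono) (auto simp: finite_pairings fin P_def)
  also have "real \<dots> \<le> pairing_count (card (P A) + card (P B) + card (P C)) * L ^ card (P A)"
  proof (rule card_pairings_avoiding_le)
    have "(card B * L + card A) * d \<le> (n * L\<^sup>2) * d"
      using key by (intro mult_right_mono) auto
    then show "card (P B) * L + card (P A) \<le> (card (P A) + card (P B) + card (P C)) * L\<^sup>2"
      unfolding n' by (simp add: cardP algebra_simps)
  qed (use fin L AB in \<open>auto simp: P_def C_def\<close>)
  finally show ?thesis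
    unfolding n' unfolding C_def cardP by (simp only: mult.commute[of d])
qed

lemma card_subsets_lessThan: "card {U. U \<subseteq> {..<n} \<and> card U = k} = n choose k"
  using n_subsets[of "{..<n}" k] by simp

text \<open>A boundary of fewer than \<open>s\<close> vertices extends to a set \<open>T\<close> of exactly \<open>s\<close> vertices outside \<open>U\<close>,
  and no edge leads from \<open>U\<close> out of \<open>U \<union> T\<close>. The sum over \<open>U\<close> and \<open>T\<close> uses the value of \<open>L\<close> for which
  \<open>n L\<^sup>2 = 2 s\<close>.\<close>
lemma card_pairings_nonexpanding_le:
  fixes n s d :: nat
  assumes s: "2 * s \<le> n" and n: "0 < n"
  shows "card {f \<in> pairings (points n d). \<exists>U \<subseteq> {..<n}. card U = s \<and>
             card (vertex_boundary {..<n} (pairing_graph (points n d) f) U) < s}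
           \<le> pairing_count (n * d) * ((n choose s)\<^sup>2 * sqrt (2 * s / n) ^ (d * s))"
proof -
  let ?X = "points n d"
  define L where "L = sqrt (2 * s / n)"
  have L: "0 \<le> L" "L \<le> 1" "n * L\<^sup>2 = 2 * s"
    using s n by (auto simp: L_def)
  let ?S = "{U. U \<subseteq> {..<n} \<and> card U = s}"
  let ?I = "SIGMA U:?S. {T \<in> ?S. U \<inter> T = {}}"
  let ?F = "\<lambda>(U, T). {f \<in> pairings ?X.
      \<forall>v\<in>U. \<forall>w\<in>{..<n} - U - T. {v, w} \<notin> pairing_graph ?X f}"
  have finS: "finite ?S" by simp
  have "card ?I \<le> card (?S \<times> ?S)"
    by (intro card_mono) (use finS in auto)
  then have cardI: "card ?I \<le> (n choose s)\<^sup>2"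
    by (simp add: card_cartesian_product card_subsets_lessThan power2_eq_square)
  have "{f \<in> pairings ?X. \<exists>U \<subseteq> {..<n}. card U = s \<and>
      card (vertex_boundary {..<n} (pairing_graph ?X f) U) < s} \<subseteq> (\<Union>i\<in>?I. ?F i)"
  proof
    fix f assume "f \<in> {f \<in> pairings ?X. \<exists>U \<subseteq> {..<n}. card U = s \<and>
      card (vertex_boundary {..<n} (pairing_graph ?X f) U) < s}"
    then obtain U where f: "f \<in> pairings ?X" and U: "U \<subseteq> {..<n}" "card U = s"
      and b: "card (vertex_boundary {..<n} (pairing_graph ?X f) U) < s" by blast
    let ?b = "vertex_boundary {..<n} (pairing_graph ?X f) U"
    have finU: "finite U" using U finite_subset by blast
    have bs: "?b \<subseteq> {..<n} - U" by (auto simp: vertex_boundary_def)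
    have "s \<le> card ({..<n} - U)"
      using U s finU by (simp add: card_Diff_subset)
    then obtain T where T: "?b \<subseteq> T" "T \<subseteq> {..<n} - U" "card T = s"
      using exists_subset_between[of ?b s "{..<n} - U"] b bs by auto
    have "f \<in> ?F (U, T)"
      using f T by (auto simp: vertex_boundary_def)
    moreover have "(U, T) \<in> ?I" using U T by auto
    ultimately show "f \<in> (\<Union>i\<in>?I. ?F i)" by blast
  qed
  then have "card {f \<in> pairings ?X. \<exists>U \<subseteq> {..<n}. card U = s \<and>
      card (vertex_boundary {..<n} (pairing_graph ?X f) U) < s} \<le> card (\<Union>i\<in>?I. ?F i)"
    by (intro card_mono finite_UN_I) (use finS in \<open>auto simp: finite_pairings\<close>)
  also have "\<dots> \<le> (\<Sum>i\<in>?I. card (?F i))"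
    by (intro card_UN_le) (use finS in auto)
  also have "real \<dots> \<le> (\<Sum>i\<in>?I. pairing_count (n * d) * L ^ (d * s))"
    unfolding of_nat_sum
  proof (rule sum_mono)
    fix i assume "i \<in> ?I"
    then obtain U T where i: "i = (U, T)" and U: "U \<subseteq> {..<n}" "card U = s"
      and T: "T \<subseteq> {..<n}" "card T = s" "U \<inter> T = {}" by blast
    have "card T * L + card U \<le> n * L\<^sup>2"
      using L mult_left_mono[of L 1 "real s"] unfolding T(2) U(2) by simp
    then show "card (?F i) \<le> pairing_count (n * d) * L ^ (d * s)"
      using card_pairings_no_edges_between_le[OF U(1) T(1,3) L(1,2)] U(2) i by simp
  qed
  also have "\<dots> = card ?I * (pairing_count (n * d) * L ^ (d * s))"
    by simp
  also have "\<dots> \<le> (n choose s)\<^sup>2 * (pairing_count (n * d) * L ^ (d * s))"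
    using cardI L by (intro mult_right_mono) (simp_all only: of_nat_le_iff, simp)
  finally show ?thesis by (simp add: L_def mult_ac)
qed

text \<open>The boundary leaves room for a set \<open>W\<close> of \<open>w\<close> vertices that has no edge to \<open>U\<close>. Now the points of
  \<open>W\<close> are revealed, because this smaller set gives the sharp bound when \<open>s\<close> is close to \<open>n/2\<close>.
  Without pairs inside \<open>W\<close> the base would be \<open>1 - s/n\<close>; the increase by \<open>w/n\<close> accounts for them, and
  it is enough since \<open>1 - s/n \<ge> 1/2\<close>.\<close>
lemma card_pairings_large_complement_le:
  fixes n s w d :: nat
  assumes s: "2 * s \<le> n" and n: "0 < n" and w: "w \<le> s"
  shows "card {f \<in> pairings (points n d). \<exists>U \<subseteq> {..<n}. card U = s \<and>
             card (vertex_boundary {..<n} (pairing_graph (points n d) f) U) + s + w \<le> n}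
           \<le> pairing_count (n * d) * (2 ^ n * (n choose w) * (1 - s / n + w / n) ^ (d * w))"
proof -
  let ?X = "points n d"
  define L where "L = 1 - s / n + w / n"
  have L: "1 / 2 \<le> L" "L \<le> 1"
  proof -
    have "s / n \<le> 1 / 2" using s n by (simp add: field_simps)
    moreover have "0 \<le> real w / n" by simp
    ultimately show "1 / 2 \<le> L" unfolding L_def by linarith
    have "w / n \<le> s / n" using w by (intro divide_right_mono) auto
    then show "L \<le> 1" unfolding L_def by linarith
  qed
  let ?S = "\<lambda>s. {U. U \<subseteq> {..<n} \<and> card U = s}"
  let ?I = "SIGMA U:?S s. {W \<in> ?S w. U \<inter> W = {}}"
  let ?F = "\<lambda>(U, W). {f \<in> pairings ?X.
      \<forall>v\<in>W. \<forall>u\<in>{..<n} - W - ({..<n} - U - W). {v, u} \<notin> pairing_graph ?X f}"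
  have finS: "finite (?S k)" for k by simp
  have "card ?I \<le> card (?S s \<times> ?S w)"
    by (intro card_mono) (use finS in auto)
  also have "\<dots> = (n choose s) * (n choose w)"
    by (simp only: card_cartesian_product card_subsets_lessThan)
  also have "\<dots> \<le> 2 ^ n * (n choose w)"
    by (intro mult_le_mono1 binomial_le_pow2)
  finally have cardI: "card ?I \<le> 2 ^ n * (n choose w)" .
  have "{f \<in> pairings ?X. \<exists>U \<subseteq> {..<n}. card U = s \<and>
      card (vertex_boundary {..<n} (pairing_graph ?X f) U) + s + w \<le> n} \<subseteq> (\<Union>i\<in>?I. ?F i)"
  proof
    fix f assume "f \<in> {f \<in> pairings ?X. \<exists>U \<subseteq> {..<n}. card U = s \<and>
      card (vertex_boundary {..<n} (pairing_graph ?X f) U) + s + w \<le> n}"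
    then obtain U where f: "f \<in> pairings ?X" and U: "U \<subseteq> {..<n}" "card U = s"
      and b: "card (vertex_boundary {..<n} (pairing_graph ?X f) U) + s + w \<le> n" by blast
    let ?b = "vertex_boundary {..<n} (pairing_graph ?X f) U"
    have finU: "finite U" using U finite_subset by blast
    have bs: "?b \<subseteq> {..<n} - U" by (auto simp: vertex_boundary_def)
    have "card ({..<n} - U - ?b) = n - s - card ?b"
      using U finU bs finite_subset[OF bs] by (simp add: card_Diff_subset)
    then have "w \<le> card ({..<n} - U - ?b)" using b by simp
    then obtain W where W: "W \<subseteq> {..<n} - U - ?b" "card W = w"
      using obtain_subset_with_card_n by metis
    have "{..<n} - W - ({..<n} - U - W) \<subseteq> U" by auto
    then have "f \<in> ?F (U, W)"
      using f W by (auto simp: vertex_boundary_def insert_commute)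
    moreover have "(U, W) \<in> ?I" using U W by auto
    ultimately show "f \<in> (\<Union>i\<in>?I. ?F i)" by blast
  qed
  then have "card {f \<in> pairings ?X. \<exists>U \<subseteq> {..<n}. card U = s \<and>
      card (vertex_boundary {..<n} (pairing_graph ?X f) U) + s + w \<le> n} \<le> card (\<Union>i\<in>?I. ?F i)"
    by (intro card_mono finite_UN_I) (use finS in \<open>auto simp: finite_pairings\<close>)
  also have "\<dots> \<le> (\<Sum>i\<in>?I. card (?F i))"
    by (intro card_UN_le) (use finS in auto)
  also have "real \<dots> \<le> (\<Sum>i\<in>?I. pairing_count (n * d) * L ^ (d * w))"
    unfolding of_nat_sum
  proof (rule sum_mono)
    fix i assume "i \<in> ?I"
    then obtain U W where i: "i = (U, W)" and U: "U \<subseteq> {..<n}" "card U = s"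
      and W: "W \<subseteq> {..<n}" "card W = w" "U \<inter> W = {}" by blast
    have fin: "finite U" "finite W" using U W finite_subset by blast+
    have "card (U \<union> W) \<le> card {..<n}"
      using U W by (intro card_mono) auto
    then have sw: "s + w \<le> n"
      using U W fin by (simp add: card_Un_disjoint)
    have "{..<n} - U - W = {..<n} - (U \<union> W)" by auto
    then have B: "card ({..<n} - U - W) = n - (s + w)"
      using U W fin by (simp add: card_Diff_subset card_Un_disjoint)
    have nL: "n * L = real n - s + w" using n by (simp add: L_def field_simps)
    have "card ({..<n} - U - W) * L + card W = (real n - s - w) * L + w"
      unfolding B W(2) using sw by (simp add: of_nat_diff)
    \<comment> \<open>\<open>n L = n - s + w\<close> exceeds the number \<open>n - s - w\<close> of remaining vertices by \<open>2 w\<close>\<close>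
    also have "\<dots> = n * L\<^sup>2 - (n * L - (real n - s - w)) * L + w"
      by (simp add: algebra_simps power2_eq_square)
    also have "\<dots> = n * L\<^sup>2 - w * (2 * L - 1)"
      unfolding nL by (simp add: algebra_simps)
    also have "\<dots> \<le> n * L\<^sup>2"
      using L by simp
    finally have key: "card ({..<n} - U - W) * L + card W \<le> n * L\<^sup>2" .
    have "{..<n} - U - W \<subseteq> {..<n}" "W \<inter> ({..<n} - U - W) = {}" "0 \<le> L"
      using L by auto
    note card_pairings_no_edges_between_le[OF W(1) this L(2) key, of d]
    then show "card (?F i) \<le> pairing_count (n * d) * L ^ (d * w)"
      by (simp only: i prod.case W(2))
  qed
  also have "\<dots> = card ?I * (pairing_count (n * d) * L ^ (d * w))"
    by simp
  also have "\<dots> \<le> real (2 ^ n * (n choose w)) * (pairing_count (n * d) * L ^ (d * w))"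
    using L by (intro mult_right_mono) (simp_all only: of_nat_le_iff cardI, simp)
  finally show ?thesis by (simp add: L_def mult_ac)
qed

section \<open>Estimates for the expected numbers\<close>

lemma choose_le_exp_power:
  assumes k: "1 \<le> k"
  shows "real (n choose k) \<le> (exp 1 * n / k) ^ k"
proof -
  have "(\<Sum>i\<in>{k}. real k ^ i /\<^sub>R fact i) \<le> (\<Sum>i. real k ^ i /\<^sub>R fact i)"
    by (rule sum_le_suminf[OF sums_summable[OF exp_converges]]) auto
  also have "\<dots> = exp (real k)"
    using sums_unique[OF exp_converges[of "real k"]] by (rule sym)
  also have "\<dots> = exp 1 ^ k"
    using exp_of_nat_mult[of k "1::real"] by simp
  finally have "real k ^ k \<le> exp 1 ^ k * fact k"
    by (simp add: field_simps)
  moreover have "real (n choose k) * fact k \<le> real n ^ k"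
    using binomial_fact_pow[of n k] by (metis of_nat_fact of_nat_le_iff of_nat_mult of_nat_power)
  ultimately have "real (n choose k) * fact k * real k ^ k \<le> real n ^ k * (exp 1 ^ k * fact k)"
    by (intro mult_mono) auto
  then have "real (n choose k) * real k ^ k \<le> (exp 1 * n) ^ k"
    by (simp add: power_mult_distrib mult_ac)
  then show ?thesis using k by (simp add: power_divide field_simps)
qed

lemma sum_arithmetico_geometric_half:
  "(\<Sum>s=1..n. real s * (1 / 2) ^ (s - 1)) = 4 - 2 * (real n + 2) * (1 / 2) ^ n"
proof (induction n)
  case (Suc n)
  have "(\<Sum>s=1..Suc n. real s * (1 / 2) ^ (s - 1))
      = 4 - 2 * (real n + 2) * (1 / 2) ^ n + real (Suc n) * (1 / 2) ^ n"
    using Suc.IH by simp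
  also have "\<dots> = 4 - 2 * (real (Suc n) + 2) * (1 / 2) ^ Suc n"
    by (simp add: algebra_simps)
  finally show ?case .
qed simp

text \<open>With \<open>r\<^sup>2 = 2s/n\<close> the left-hand side is at most \<open>A\<^sup>s\<close> for \<open>A = 4 e\<^sup>2 r\<^bsup>d-4\<^esup>\<close>. The hypothesis
  \<open>r\<^sup>2 \<le> 1 - 20/d\<close> gives \<open>A \<le> 1/2\<close>. Bounding one of the \<open>s\<close> factors by \<open>A \<le> 4 e\<^sup>2 r\<^sup>2\<close> instead makes the
  sum over \<open>s\<close> of order \<open>1/n\<close>.\<close>
lemma small_set_term_le:
  fixes d n s :: nat
  assumes d: "8 \<le> d" and s: "1 \<le> s" "2 * s \<le> (1 - 20 / d) * n"
  shows "(n choose s)\<^sup>2 * sqrt (2 * s / n) ^ (d * s) \<le> 8 * exp 2 / n * (s * (1 / 2) ^ (s - 1))"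
proof -
  have n: "0 < n" using s by (intro Nat.gr0I) auto
  define r where "r = sqrt (2 * s / n)"
  define A where "A = 4 * exp 2 * r ^ (d - 4)"
  have r: "0 < r" "r\<^sup>2 = 2 * s / n" using n s by (simp_all add: r_def)
  have "r\<^sup>2 \<le> 1 - 20 / d" unfolding r(2) using s(2) n by (simp add: divide_le_eq)
  also have "\<dots> \<le> exp (- 20 / d)" using exp_ge_add_one_self[of "- 20 / d"] by simp
  also have "\<dots> = (exp (- 10 / d))\<^sup>2"
    using exp_of_nat_mult[of 2 "- 10 / real d"] by simp
  finally have r_le: "r \<le> exp (- 10 / d)" by (rule power2_le_imp_le) simp
  also have "\<dots> \<le> 1" by simp
  finally have r1: "r \<le> 1" .
  have A0: "0 \<le> A" using r by (simp add: A_def)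
  have A_half: "A \<le> 1 / 2"
  proof -
    have "r ^ (d - 4) \<le> exp (- 10 / d) ^ (d - 4)"
      using r r_le by (intro power_mono) auto
    also have "\<dots> = exp (real (d - 4) * (- 10 / d))"
      by (rule exp_of_nat_mult[symmetric])
    also have "real (d - 4) * (- 10 / d) = - 10 + 40 / d"
      using d by (simp add: field_simps of_nat_diff)
    also have "exp (- 10 + 40 / d) \<le> exp (- 5)"
      using d by (simp add: field_simps)
    finally have "A \<le> 4 * exp 2 * exp (- 5)" by (simp add: A_def)
    also have "\<dots> = 4 * exp (- 3)" by (simp flip: exp_add)
    also have "exp (- 3 :: real) \<le> 1 / 8"
    proof -
      have "(2::real) ^ 3 \<le> exp 1 ^ 3"
        using exp_ge_add_one_self[of 1] by (intro power_mono) auto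
      also have "\<dots> = exp 3" using exp_of_nat_mult[of 3 "1::real"] by simp
      finally show ?thesis by (simp add: exp_minus divide_simps)
    qed
    finally show ?thesis by simp
  qed
  have A_small: "A \<le> 8 * exp 2 / n * s"
  proof -
    have "r ^ (d - 4) \<le> r ^ 2" using r r1 d by (intro power_decreasing) auto
    then show ?thesis unfolding A_def r(2) using n by (simp add: field_simps)
  qed
  have "real (n choose s) \<le> (exp 1 * n / s) ^ s" by (rule choose_le_exp_power[OF s(1)])
  also have "exp 1 * n / s = 2 * exp 1 / r\<^sup>2" unfolding r(2) using n s by simp
  finally have "(real (n choose s))\<^sup>2 \<le> ((2 * exp 1 / r\<^sup>2) ^ s)\<^sup>2"
    by (intro power_mono) auto
  also have "\<dots> = ((2 * exp 1 / r\<^sup>2)\<^sup>2) ^ s"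
    by (simp only: power_mult[symmetric] mult.commute)
  also have "(2 * exp 1 / r\<^sup>2)\<^sup>2 = 4 * exp 2 / r ^ 4"
  proof -
    have "(exp 1 :: real)\<^sup>2 = exp 2" using exp_of_nat_mult[of 2 "1::real"] by simp
    then show ?thesis by (simp add: power_divide power_mult_distrib flip: power_mult)
  qed
  finally have "(real (n choose s))\<^sup>2 * r ^ (d * s) \<le> (4 * exp 2 / r ^ 4) ^ s * r ^ (d * s)"
    using r by (intro mult_right_mono) auto
  also have "\<dots> = (4 * exp 2 / r ^ 4 * r ^ d) ^ s"
    by (simp only: power_mult power_mult_distrib)
  also have "4 * exp 2 / r ^ 4 * r ^ d = A"
    using r d by (simp add: A_def power_diff)
  also have "A ^ s = A * A ^ (s - 1)" using s by (simp add: power_eq_if)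
  also have "\<dots> \<le> (8 * exp 2 / n * s) * (1 / 2) ^ (s - 1)"
    using A0 by (intro mult_mono A_small power_mono A_half) auto
  finally show ?thesis by (simp add: r_def mult.assoc)
qed

text \<open>Write \<open>h = 1/d\<close> and \<open>\<delta> = 5000 (ln d)/d\<^sup>2\<close>. Since \<open>s\<close> lies between \<open>(1/2 - 10 h) n\<close> and \<open>n/2\<close>, \<open>w\<close> lies
  between \<open>(h + \<delta>/2) n\<close> and \<open>23 h n\<close>. The base of the power is at most \<open>(1 + 66 h)/2\<close>, and so
  the logarithm of the left-hand side is at most
  \<open>n ln 2 - d w ln 2 + w (1 + ln d) + 66 w\<close>. The lower bound for \<open>w\<close> turns the first two terms into at
  most \<open>- 1250 n h ln d\<close>, while the upper bound limits the others to \<open>23 n h (67 + ln d)\<close>. As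
  \<open>ln d \<ge> 2\<close>, the total is at most \<open>- n h\<close>.\<close>
lemma large_set_term_le:
  fixes d n s w :: nat and l :: real
  assumes l_def: "l = 1 - 2 / real d - 5000 * ln (real d) / (real d)\<^sup>2"
    and d: "100 \<le> d" "2 \<le> ln (real d)" "5000 * ln (real d) \<le> 2 * real d" and n: "d \<le> n"
    and s: "2 * s \<le> n" "(1 - 20 / real d) * real n < 2 * real s"
    and w: "w = n - s - nat \<lfloor>l * real s\<rfloor>"
  shows "w \<le> s" "2 ^ n * real (n choose w) * (1 - real s / real n + real w / real n) ^ (d * w) \<le> exp (- real n / real d)"
proof -
  define h where "h = 1 / real d"
  define \<delta> where "\<delta> = 5000 * ln (real d) / (real d)\<^sup>2"
  have dpos: "0 < real d" and npos: "0 < real n" using d(1) n by auto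
  have h: "0 < h" "h \<le> 1 / 100" "real d * h = 1" using d(1) by (auto simp: h_def field_simps)
  have l: "l = 1 - 2 * h - \<delta>" by (simp add: l_def h_def \<delta>_def)
  have d\<delta>: "real d * \<delta> = 5000 * ln (real d) * h" using dpos by (simp add: \<delta>_def h_def power2_eq_square)
  have \<delta>: "0 \<le> \<delta>" "\<delta> \<le> 2 * h"
  proof -
    show "0 \<le> \<delta>" using d(2) by (simp add: \<delta>_def)
    have "\<delta> \<le> 2 * real d / (real d)\<^sup>2" unfolding \<delta>_def using d(3) by (intro divide_right_mono) auto
    then show "\<delta> \<le> 2 * h" using dpos by (simp add: h_def power2_eq_square)
  qed
  have nh: "1 \<le> real n * h" using n dpos by (simp add: h_def)
  have w_real: "real w = real n - real s - real_of_int \<lfloor>l * real s\<rfloor>"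
  proof -
    have l01: "0 \<le> l" "l \<le> 1" using l h \<delta> by auto
    have "0 \<le> \<lfloor>l * real s\<rfloor>" using l01 by simp
    moreover have "l * real s \<le> real s" using l01 by (simp add: mult_left_le_one_le)
    then have "\<lfloor>l * real s\<rfloor> \<le> int s" by (simp add: floor_le_iff)
    ultimately show ?thesis using s(1) unfolding w by (simp add: of_nat_diff)
  qed
  have w_lower: "real n * (1 + real d * \<delta> / 2) \<le> real d * real w"
  proof -
    have "real n * (h + \<delta> / 2) = real n - (real n / 2) * (2 - 2 * h - \<delta>)" by (simp add: algebra_simps)
    also have "\<dots> \<le> real n - real s * (2 - 2 * h - \<delta>)"
      using s(1) h \<delta> by (intro diff_left_mono mult_right_mono) auto
    also have "\<dots> = real n - real s - l * real s" by (simp add: l algebra_simps)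
    also have "\<dots> \<le> real w" unfolding w_real by simp
    finally have "real d * (real n * (h + \<delta> / 2)) \<le> real d * real w" by (intro mult_left_mono) auto
    moreover have "real d * (real n * (h + \<delta> / 2)) = real n * (real d * h + real d * \<delta> / 2)" by (simp add: algebra_simps)
    ultimately show ?thesis using h(3) by simp
  qed
  have s_lower: "real n * (1 / 2 - 10 * h) \<le> real s"
    using s(2) by (simp add: h_def algebra_simps)
  have w_upper: "real w \<le> 23 * (real n * h)"
  proof -
    have "real w \<le> real n - real s - l * real s + 1" unfolding w_real by linarith
    also have "\<dots> = real n - real s * (2 - 2 * h - \<delta>) + 1" by (simp add: l algebra_simps)
    also have "\<dots> \<le> real n - (real n * (1 / 2 - 10 * h)) * (2 - 2 * h - \<delta>) + 1"
      using s_lower h \<delta> by (intro add_right_mono diff_left_mono mult_right_mono) auto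
    also have "\<dots> = real n * (21 * h + \<delta> / 2 - 20 * (h * h) - 10 * (h * \<delta>)) + 1"
      by (simp add: algebra_simps)
    also have "\<dots> \<le> real n * (22 * h) + 1"
    proof -
      have "0 \<le> h * h" "0 \<le> h * \<delta>" using h \<delta> by auto
      then have "21 * h + \<delta> / 2 - 20 * (h * h) - 10 * (h * \<delta>) \<le> 22 * h"
        using \<delta> by linarith
      then show ?thesis by (intro add_right_mono mult_left_mono) auto
    qed
    also have "\<dots> \<le> 23 * (real n * h)" using nh by (simp add: mult.commute)
    finally show ?thesis .
  qed
  have "real n * h \<le> real n * (1 / 100)" using h by (intro mult_left_mono) auto
  then have "real w \<le> real s" using w_upper s_lower by (simp add: algebra_simps)
  then show "w \<le> s" by simp
  have w_nh: "real n * h \<le> real w"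
  proof -
    have "real n * 1 \<le> real n * (1 + real d * \<delta> / 2)" using \<delta> by (intro mult_left_mono) auto
    then have "real n \<le> real d * real w" using w_lower by linarith
    then show ?thesis using dpos by (simp add: h_def divide_le_eq mult.commute)
  qed
  then have w1: "1 \<le> w" using nh by linarith
  have choose: "real (n choose w) \<le> exp (real w * (1 + ln (real d)))"
  proof -
    have "real (n choose w) \<le> (exp 1 * real n / real w) ^ w" by (rule choose_le_exp_power[OF w1])
    also have "\<dots> \<le> (exp 1 * real d) ^ w"
    proof (rule power_mono)
      have "real n \<le> real d * real w" using w_nh dpos by (simp add: h_def divide_le_eq mult.commute)
      then show "exp 1 * real n / real w \<le> exp 1 * real d" using w1 by (simp add: divide_le_eq)
    qed simp
    also have "exp 1 * real d = exp (1 + ln (real d))" using dpos by (simp add: exp_add)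
    finally show ?thesis by (simp flip: exp_of_nat_mult)
  qed
  define L where "L = 1 - real s / real n + real w / real n"
  have "0 \<le> L"
  proof -
    have "real s / real n \<le> 1" using s(1) npos by simp
    then show ?thesis by (simp add: L_def)
  qed
  have "L \<le> exp (66 * h - ln 2)"
  proof -
    have "1 / 2 - 10 * h \<le> real s / real n" using s_lower npos by (simp add: le_divide_eq mult.commute)
    moreover have "real w / real n \<le> 23 * h" using w_upper npos by (simp add: divide_le_eq mult_ac)
    moreover have "1 - x + y \<le> (1 + 66 * h) / 2" if "1 / 2 - 10 * h \<le> x" "y \<le> 23 * h" for x y
      using that by argo
    ultimately have "L \<le> (1 + 66 * h) / 2" unfolding L_def by blast
    also have "\<dots> \<le> exp (66 * h) / 2"
      by (rule divide_right_mono) (use exp_ge_add_one_self[of "66 * h"] in simp_all)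
    finally show ?thesis by (simp add: exp_diff)
  qed
  then have "L ^ (d * w) \<le> exp (66 * h - ln 2) ^ (d * w)"
    using \<open>0 \<le> L\<close> by (intro power_mono) auto
  also have "\<dots> = exp (real (d * w) * (66 * h - ln 2))"
    by (rule exp_of_nat_mult[symmetric])
  also have "real (d * w) * (66 * h - ln 2) = 66 * real w * (real d * h) - ln 2 * (real d * real w)"
    by (simp add: algebra_simps)
  finally have L_pow: "L ^ (d * w) \<le> exp (66 * real w - ln 2 * (real d * real w))" using h(3) by simp
  have "2 ^ n * real (n choose w) * L ^ (d * w)
      \<le> exp (real n * ln 2) * exp (real w * (1 + ln (real d))) * exp (66 * real w - ln 2 * (real d * real w))"
    using choose L_pow \<open>0 \<le> L\<close> by (intro mult_mono) (auto simp: exp_of_nat_mult)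
  also have "\<dots> = exp (real n * ln 2 + real w * (67 + ln (real d)) - ln 2 * (real d * real w))"
    by (simp flip: exp_add) (simp add: algebra_simps)
  also have "\<dots> \<le> exp (- real n / real d)"
  proof -
    have "ln 2 * (real n * (1 + real d * \<delta> / 2)) \<le> ln 2 * (real d * real w)"
      using w_lower by (intro mult_left_mono) auto
    moreover have "(1 / 2) * (real n * (real d * \<delta>) / 2) \<le> ln 2 * (real n * (real d * \<delta>) / 2)"
      using \<delta> ln2_ge_two_thirds by (intro mult_right_mono) auto
    moreover have "ln 2 * (real n * (1 + real d * \<delta> / 2)) = real n * ln 2 + ln 2 * (real n * (real d * \<delta>) / 2)"
      by (simp add: algebra_simps)
    ultimately have 1: "real n * ln 2 - ln 2 * (real d * real w) \<le> - (1250 * (real n * h) * ln (real d))"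
      unfolding d\<delta> by (simp add: algebra_simps)
    have 2: "real w * (67 + ln (real d)) \<le> (23 * (real n * h)) * (67 + ln (real d))"
      using w_upper d(2) by (intro mult_right_mono) auto
    have 3: "(real n * h) * (1542 - 1227 * ln (real d)) \<le> 0"
      using nh d(2) by (intro mult_nonneg_nonpos) auto
    have "real n * ln 2 + real w * (67 + ln (real d)) - ln 2 * (real d * real w) \<le> - (real n * h)"
      using 1 2 3 by (simp add: algebra_simps)
    then show ?thesis by (simp add: h_def)
  qed
  finally show "2 ^ n * real (n choose w) * (1 - real s / real n + real w / real n) ^ (d * w) \<le> exp (- real n / real d)"
    by (simp add: L_def)
qed

section \<open>Expansion of random regular graphs\<close>

lemma half_vertex_expansion_ge_iff:
  assumes n: "2 \<le> n"
  shows "l \<le> half_vertex_expansion {..<n} E \<longleftrightarrow>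
    (\<forall>U. U \<subseteq> {..<n} \<and> U \<noteq> {} \<and> 2 * card U \<le> n \<longrightarrow>
      l * real (card U) \<le> real (card (vertex_boundary {..<n} E U)))"
proof -
  let ?r = "\<lambda>U. real (card (vertex_boundary {..<n} E U)) / real (card U)"
  define F where "F = {U. U \<subseteq> {..<n} \<and> U \<noteq> {} \<and> 2 * card U \<le> n}"
  have half: "real (card U) \<le> real n / 2 \<longleftrightarrow> 2 * card U \<le> n" for U :: "nat set"
    by linarith
  have eq: "half_vertex_expansion {..<n} E = Min (?r ` F)"
    unfolding half_vertex_expansion_def F_def card_lessThan half
    by (rule arg_cong[where f = Min]) auto
  have fin: "finite F"
    by (rule finite_subset[of _ "Pow {..<n}"]) (auto simp: F_def)
  have "{0} \<in> F" using n by (auto simp: F_def)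
  then have ne: "F \<noteq> {}" by blast
  have pos: "0 < real (card U)" if "U \<in> F" for U
    using that finite_subset[of U "{..<n}"] by (auto simp: F_def card_gt_0_iff)
  have "l \<le> Min (?r ` F) \<longleftrightarrow> (\<forall>U\<in>F. l \<le> ?r U)"
    using fin ne by simp
  also have "\<dots> \<longleftrightarrow> (\<forall>U\<in>F. l * real (card U) \<le> real (card (vertex_boundary {..<n} E U)))"
    using pos by (intro ball_cong refl) (simp add: le_divide_eq)
  finally show ?thesis unfolding eq F_def by blast
qed

text \<open>The union bound over the size \<open>s\<close> of a violating set, where \<open>a s\<close> covers the sizes up to
  \<open>(1 - 20/d) n/2\<close> and \<open>b\<close> covers the others.\<close>
lemma card_pairings_violating_le:
  fixes d n :: nat and l :: real
  assumes l: "l = 1 - 2 / real d - 5000 * ln (real d) / (real d)\<^sup>2"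
    and d: "100 \<le> d" "2 \<le> ln (real d)" "5000 * ln (real d) \<le> 2 * real d" and n: "d \<le> n"
  shows "real (card {f \<in> simple_pairings n d.
            \<not> l \<le> half_vertex_expansion {..<n} (pairing_graph (points n d) f)})
          \<le> (32 * exp 2 / real n + real n * exp (- real n / real d)) * real (pairing_count (n * d))"
proof -
  define G where "G f = pairing_graph (points n d) f" for f
  define bad where "bad s = {f \<in> pairings (points n d). \<exists>U \<subseteq> {..<n}. card U = s \<and>
      real (card (vertex_boundary {..<n} (G f) U)) < l * real s}" for s
  define a where "a s = 8 * exp 2 / real n * (real s * (1 / 2) ^ (s - 1))" for s :: nat
  define b where "b = exp (- real n / real d)"
  define pc where "pc = real (pairing_count (n * d))"
  have n0: "0 < n" "2 \<le> n" using d(1) n by auto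
  have fin: "finite (pairings (points n d))" by (simp add: finite_pairings)
  have l1: "0 \<le> l" "l \<le> 1"
  proof -
    have "5000 * ln (real d) / (real d)\<^sup>2 \<le> 2 * real d / (real d)\<^sup>2"
      using d(3) by (intro divide_right_mono) auto
    also have "\<dots> = 2 / real d" using d(1) by (simp add: power2_eq_square)
    finally have "1 - 4 / real d \<le> l" unfolding l by simp
    moreover have "4 / real d \<le> 1" using d(1) by simp
    ultimately show "0 \<le> l" by linarith
    have "0 \<le> 5000 * ln (real d) / (real d)\<^sup>2" using d(2) by simp
    moreover have "0 \<le> 2 / real d" by simp
    ultimately show "l \<le> 1" unfolding l by linarith
  qed
  have bad_le: "real (card (bad s)) \<le> pc * (a s + b)" if s: "1 \<le> s" "2 * s \<le> n" for s
  proof (cases "real (2 * s) \<le> (1 - 20 / real d) * real n")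
    case True
    have "bad s \<subseteq> {f \<in> pairings (points n d). \<exists>U \<subseteq> {..<n}. card U = s \<and>
        card (vertex_boundary {..<n} (pairing_graph (points n d) f) U) < s}"
    proof -
      have "l * real s \<le> real s" using l1 by (simp add: mult_left_le_one_le)
      then have "k < s" if "real k < l * real s" for k :: nat using that by linarith
      then show ?thesis unfolding bad_def G_def by blast
    qed
    then have "card (bad s) \<le> card {f \<in> pairings (points n d). \<exists>U \<subseteq> {..<n}. card U = s \<and>
        card (vertex_boundary {..<n} (pairing_graph (points n d) f) U) < s}"
      by (intro card_mono) (use fin in auto)
    then have "real (card (bad s))
        \<le> pc * (real ((n choose s)\<^sup>2) * sqrt (real (2 * s) / real n) ^ (d * s))"
      using card_pairings_nonexpanding_le[OF s(2) n0(1), of d] unfolding pc_def by linarith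
    also have "\<dots> \<le> pc * a s"
      using small_set_term_le[of d s n] d(1) s(1) True
      by (intro mult_left_mono) (auto simp: a_def pc_def)
    also have "\<dots> \<le> pc * (a s + b)"
      by (intro mult_left_mono) (auto simp: pc_def b_def)
    finally show ?thesis .
  next
    case False
    define w where "w = n - s - nat \<lfloor>l * real s\<rfloor>"
    have F: "(1 - 20 / real d) * real n < 2 * real s" using False by simp
    note large = large_set_term_le[OF l d n s(2) F w_def]
    have "bad s \<subseteq> {f \<in> pairings (points n d). \<exists>U \<subseteq> {..<n}. card U = s \<and>
        card (vertex_boundary {..<n} (pairing_graph (points n d) f) U) + s + w \<le> n}"
    proof -
      have "l * real s \<le> real s" using l1 by (simp add: mult_left_le_one_le)
      then have "nat \<lfloor>l * real s\<rfloor> \<le> s" by (simp add: nat_le_iff floor_le_iff)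
      moreover have "k \<le> nat \<lfloor>l * real s\<rfloor>" if "real k < l * real s" for k :: nat
        using that by (simp add: le_nat_floor)
      ultimately have "k + s + w \<le> n" if "real k < l * real s" for k :: nat
        using that s(2) unfolding w_def by fastforce
      then show ?thesis unfolding bad_def G_def by blast
    qed
    then have "card (bad s) \<le> card {f \<in> pairings (points n d). \<exists>U \<subseteq> {..<n}. card U = s \<and>
        card (vertex_boundary {..<n} (pairing_graph (points n d) f) U) + s + w \<le> n}"
      by (intro card_mono) (use fin in auto)
    then have "real (card (bad s)) \<le> pc * (real (2 ^ n * (n choose w)) *
        (1 - real s / real n + real w / real n) ^ (d * w))"
      using card_pairings_large_complement_le[OF s(2) n0(1) large(1), of d] unfolding pc_def by linarith
    also have "\<dots> \<le> pc * b"
      using large(2) by (intro mult_left_mono) (auto simp: b_def pc_def)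
    also have "\<dots> \<le> pc * (a s + b)"
      by (intro mult_left_mono) (auto simp: pc_def a_def)
    finally show ?thesis .
  qed
  let ?S = "{s \<in> {1..n}. 2 * s \<le> n}"
  have "{f \<in> simple_pairings n d. \<not> l \<le> half_vertex_expansion {..<n} (G f)} \<subseteq> (\<Union>s\<in>?S. bad s)"
  proof
    fix f assume "f \<in> {f \<in> simple_pairings n d. \<not> l \<le> half_vertex_expansion {..<n} (G f)}"
    then have f: "f \<in> pairings (points n d)" and "\<not> l \<le> half_vertex_expansion {..<n} (G f)"
      by (simp_all add: simple_pairings_def)
    then obtain U where U: "U \<subseteq> {..<n}" "U \<noteq> {}" "2 * card U \<le> n"
        "real (card (vertex_boundary {..<n} (G f) U)) < l * real (card U)"
      unfolding half_vertex_expansion_ge_iff[OF n0(2)] by (meson not_le)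
    have "f \<in> bad (card U)" using f U unfolding bad_def by blast
    moreover have "card U \<in> ?S"
      using U finite_subset[OF U(1)] by (simp add: Suc_le_eq card_gt_0_iff)
    ultimately show "f \<in> (\<Union>s\<in>?S. bad s)" by blast
  qed
  then have "card {f \<in> simple_pairings n d. \<not> l \<le> half_vertex_expansion {..<n} (G f)}
      \<le> card (\<Union>s\<in>?S. bad s)"
    by (intro card_mono finite_UN_I) (use fin in \<open>auto simp: bad_def\<close>)
  also have "\<dots> \<le> (\<Sum>s\<in>?S. card (bad s))" by (rule card_UN_le) simp
  finally have "real (card {f \<in> simple_pairings n d. \<not> l \<le> half_vertex_expansion {..<n} (G f)})
      \<le> (\<Sum>s\<in>?S. real (card (bad s)))"
    by (simp flip: of_nat_sum)
  also have "\<dots> \<le> (\<Sum>s\<in>?S. pc * (a s + b))"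
    by (intro sum_mono bad_le) auto
  also have "\<dots> \<le> (\<Sum>s=1..n. pc * (a s + b))"
    by (intro sum_mono2) (auto simp: pc_def a_def b_def)
  also have "\<dots> = pc * ((\<Sum>s=1..n. a s) + real n * b)"
    by (simp add: sum.distrib flip: sum_distrib_left)
  also have "\<dots> \<le> pc * (32 * exp 2 / real n + real n * b)"
  proof (intro mult_left_mono add_right_mono)
    have "(\<Sum>s=1..n. a s) = 8 * exp 2 / real n * (4 - 2 * (real n + 2) * (1 / 2) ^ n)"
      unfolding a_def sum_distrib_left[symmetric] sum_arithmetico_geometric_half ..
    also have "\<dots> \<le> 8 * exp 2 / real n * 4"
      by (intro mult_left_mono) auto
    finally show "(\<Sum>s=1..n. a s) \<le> 32 * exp 2 / real n" by simp
  qed (simp add: pc_def)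
  finally show ?thesis by (simp add: G_def pc_def b_def mult.commute)
qed

lemma holds_aas_half_vertex_expansion_ge:
  fixes d :: nat and l :: real
  assumes l: "l = 1 - 2 / real d - 5000 * ln (real d) / (real d)\<^sup>2"
    and d: "100 \<le> d" "2 \<le> ln (real d)" "5000 * ln (real d) \<le> 2 * real d"
  shows "holds_aas d (\<lambda>n E. l \<le> half_vertex_expansion {..<n} E)"
proof -
  define D where "D = d + d * d"
  define K where "K = 2 * (1 + 2 * real D) ^ (4 * D)"
  define \<beta> where "\<beta> n = 32 * exp 2 / real n + real n * exp (- real n / real d)" for n :: nat
  define p where "p n = measure_pmf.prob (random_regular_graph n d)
      {E. l \<le> half_vertex_expansion {..<n} E}" for n
  let ?F = "inf at_top (principal {n. even (d * n)})"
  have dpos: "0 < real d" using d(1) by simp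
  have ge: "1 - K * \<beta> n \<le> p n" if n: "12 * D \<le> n" and even: "even (d * n)" for n
  proof -
    have "n * 1 \<le> n * d" using d(1) by (intro mult_le_mono) auto
    then have M: "12 * (d + d * d) \<le> n * d" using n unfolding D_def by linarith
    have "d \<le> D" by (simp add: D_def)
    then have dn: "d \<le> n" using n by linarith
    have "measure_pmf.prob (random_regular_graph n d) {E. \<not> l \<le> half_vertex_expansion {..<n} E}
        \<le> K * \<beta> n"
      unfolding K_def D_def
      by (rule prob_random_regular_graph_le[OF _ M])
         (use d(1) even card_pairings_violating_le[OF l d dn] in \<open>auto simp: \<beta>_def mult.commute\<close>)
    moreover have "p n = 1 - measure_pmf.prob (random_regular_graph n d)
        {E. \<not> l \<le> half_vertex_expansion {..<n} E}"
      unfolding p_def using measure_pmf.prob_compl[of "{E. \<not> l \<le> half_vertex_expansion {..<n} E}"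
          "random_regular_graph n d"]
      by (simp add: Compl_eq_Diff_UNIV[symmetric] Collect_neg_eq[symmetric])
    ultimately show ?thesis by simp
  qed
  have "\<beta> \<longlonglongrightarrow> 0"
    unfolding \<beta>_def using dpos by real_asymp
  then have lim: "(\<lambda>n. 1 - K * \<beta> n) \<longlonglongrightarrow> 1"
    by (auto intro!: tendsto_eq_intros)
  have "(p \<longlongrightarrow> 1) ?F"
  proof (rule tendsto_sandwich)
    show "\<forall>\<^sub>F n in ?F. 1 - K * \<beta> n \<le> p n"
      unfolding eventually_inf_principal
      using eventually_ge_at_top[of "12 * D"] by eventually_elim (auto intro: ge)
    show "\<forall>\<^sub>F n in ?F. p n \<le> 1" by (simp add: p_def)
    show "((\<lambda>n. 1 - K * \<beta> n) \<longlongrightarrow> 1) ?F"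
      by (rule tendsto_mono[OF inf_le1 lim])
  qed simp
  then show ?thesis unfolding holds_aas_def p_def .
qed

text \<open>The first half of the vertices of a graph of even order \<open>2 m\<close> has at most \<open>2 m\<close> boundary
  vertices. Even orders satisfy the parity condition for every \<open>d\<close>, so the limit is taken along a
  nontrivial filter.\<close>
lemma holds_aas_half_vertex_expansion_bound:
  assumes "holds_aas d (\<lambda>n E. l \<le> half_vertex_expansion {..<n} E)"
  shows "l \<le> 2"
proof -
  let ?p = "\<lambda>n. measure_pmf.prob (random_regular_graph n d) {E. l \<le> half_vertex_expansion {..<n} E}"
  have "\<forall>\<^sub>F n in inf at_top (principal {n. even (d * n)}). 0 < ?p n"
    using assms unfolding holds_aas_def by (rule order_tendstoD) simp
  then obtain N where N: "\<And>n. N \<le> n \<Longrightarrow> even (d * n) \<Longrightarrow> 0 < ?p n"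
    unfolding eventually_inf_principal eventually_at_top_linorder by auto
  define m where "m = N + 1"
  have "0 < ?p (2 * m)" by (rule N) (simp_all add: m_def)
  then have "{E. l \<le> half_vertex_expansion {..<2 * m} E} \<noteq> {}"
    by (metis less_irrefl measure_empty)
  then obtain E where E: "l \<le> half_vertex_expansion {..<2 * m} E" by blast
  have "2 \<le> 2 * m" by (simp add: m_def)
  moreover have "{..<m} \<subseteq> {..<2 * m} \<and> {..<m} \<noteq> {} \<and> 2 * card {..<m} \<le> 2 * m"
    by (auto simp: m_def)
  ultimately have "l * real (card {..<m}) \<le> real (card (vertex_boundary {..<2 * m} E {..<m}))"
    using E half_vertex_expansion_ge_iff by blast
  also have "card (vertex_boundary {..<2 * m} E {..<m}) \<le> card {..<2 * m}"
    by (intro card_mono) (auto simp: vertex_boundary_def)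
  finally have "l * real m \<le> 2 * real m" by simp
  moreover have "0 < real m" by (simp add: m_def)
  ultimately show ?thesis by simp
qed

lemma iV_ge:
  assumes "holds_aas d (\<lambda>n E. l \<le> half_vertex_expansion {..<n} E)"
  shows "l \<le> iV d"
  unfolding iV_def
proof (rule cSup_upper)
  show "bdd_above {l. holds_aas d (\<lambda>n E. l \<le> half_vertex_expansion {..<n} E)}"
    by (rule bdd_aboveI[of _ 2]) (auto intro: holds_aas_half_vertex_expansion_bound)
qed (use assms in simp)

theorem corollary2:
  "\<exists>\<epsilon> :: nat \<Rightarrow> real.
     \<epsilon> \<in> O(\<lambda>d. ln (real d) / (real d)\<^sup>2) \<and>
     (\<forall>\<^sub>F d in at_top. iV d \<ge> 1 - 2 / real d + \<epsilon> d)"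
proof (intro exI conjI)
  let ?\<epsilon> = "\<lambda>d. - 5000 * (ln (real d) / (real d)\<^sup>2)"
  show "?\<epsilon> \<in> O(\<lambda>d. ln (real d) / (real d)\<^sup>2)"
    by (intro bigoI[of _ 5000] always_eventually allI) (simp add: abs_mult)
  have "\<forall>\<^sub>F d::nat in at_top. 100 \<le> d" by (rule eventually_ge_at_top)
  moreover have "\<forall>\<^sub>F d::nat in at_top. 2 \<le> ln (real d)" by real_asymp
  moreover have "\<forall>\<^sub>F d::nat in at_top. 5000 * ln (real d) \<le> 2 * real d" by real_asymp
  ultimately show "\<forall>\<^sub>F d in at_top. iV d \<ge> 1 - 2 / real d + ?\<epsilon> d"
  proof eventually_elim
    case (elim d)
    then have "1 - 2 / real d - 5000 * ln (real d) / (real d)\<^sup>2 \<le> iV d"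
      by (intro iV_ge holds_aas_half_vertex_expansion_ge[OF refl])
    then show ?case by simp
  qed
qed

end
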